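(* Let $F$ be a field and let $q,n,e\in\mathbb{N}$ with $q>1$ and $e\mid q^n-1$. If $m=m(q,e)\ge e/3$, then $$\mathrm{LL}(A(q,n,e))=\left\lfloor n\frac{q-1}{m}\right\rfloor+1.$$
   Context: $\mathbb{N}$ denotes the set of positive integers, $\mathbb{N}_0=\mathbb{N}\cup\{0\}$. For $q,e\in\mathbb{N}$ with $\gcd(q,e)=1$, $m(q,e)$ is the smallest positive integer $t$ such that there exist $i_1,\dots,i_t\in\mathbb{N}_0$ (repetitions allowed) with $e\mid q^{i_1}+\dots+q^{i_t}$. For a field $F$ and $q,n,e\in\mathbb{N}$ with $q>1$ and $e\mid q^n-1$, let $I=(X_1^q,\dots,X_n^q)$ in the polynomial algebra $F[X_1,\dots,X_n]$ and $x_j=X_j+I$. Then $A(q,n,e)$ is the unital $F$-subalgebra of $F[x_1,\dots,x_n]=F[X_1,\dots,X_n]/I$ generated by all monomials $x_1^{i_1}\cdots x_n^{i_n}$ with $i_1+qi_2+\dots+q^{n-1}i_n\equiv 0\pmod e$. For a finite-dimensional algebra $A$ with Jacobson radical $\mathrm{J}(A)$, the Loewy length $\mathrm{LL}(A)$ is the smallest $l\in\mathbb{N}_0$ with $\mathrm{J}(A)^l=0$. *)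

theory Defs
  imports Complex_Main "HOL-Library.Poly_Mapping" "HOL-Algebra.Algebra" "HOL-Number_Theory.Cong"
begin

definition min_power_sum_length :: "nat \<Rightarrow> nat \<Rightarrow> nat" where
  "min_power_sum_length q e =
    (LEAST t. 0 < t \<and> (\<exists>ks :: nat list. length ks = t \<and> e dvd (\<Sum>k\<leftarrow>ks. q ^ k)))"

text \<open>
  A polynomial is a finitely supported map from exponent vectors to coefficients; an exponent
  vector is a finitely supported map from variable indices to naturals.
  The ring \<open>mpoly_ring n\<close> is $F[X_1,\dots,X_n]$, with $F$ given by the type \<open>'f\<close>.
\<close>

type_synonym 'f mpoly = "(nat \<Rightarrow>\<^sub>0 nat) \<Rightarrow>\<^sub>0 'f"

definition mpoly_ring :: "nat \<Rightarrow> ('f::field) mpoly ring" where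
  "mpoly_ring n =
    \<lparr>carrier = {p. \<forall>v \<in> Poly_Mapping.keys p. Poly_Mapping.keys v \<subseteq> {1..n}},
     monoid.mult = (*), monoid.one = 1, ring.zero = 0, ring.add = (+)\<rparr>"

definition mpoly_var :: "nat \<Rightarrow> ('f::field) mpoly" where
  "mpoly_var j = Poly_Mapping.single (Poly_Mapping.single j 1) 1"

definition mpoly_const :: "'f::field \<Rightarrow> 'f mpoly" where
  "mpoly_const c = Poly_Mapping.single 0 c"

definition trunc_ideal :: "nat \<Rightarrow> nat \<Rightarrow> ('f::field) mpoly set" where
  "trunc_ideal q n = Idl\<^bsub>mpoly_ring n\<^esub> ((\<lambda>j. mpoly_var j [^]\<^bsub>mpoly_ring n\<^esub> q) ` {1..n})"

definition trunc_ring :: "nat \<Rightarrow> nat \<Rightarrow> ('f::field) mpoly set ring" where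
  "trunc_ring q n = mpoly_ring n Quot trunc_ideal q n"

definition trunc_var :: "nat \<Rightarrow> nat \<Rightarrow> nat \<Rightarrow> ('f::field) mpoly set" where
  "trunc_var q n j = trunc_ideal q n +>\<^bsub>mpoly_ring n\<^esub> mpoly_var j"

definition trunc_scalars :: "nat \<Rightarrow> nat \<Rightarrow> ('f::field) mpoly set set" where
  "trunc_scalars q n = range (\<lambda>c. trunc_ideal q n +>\<^bsub>mpoly_ring n\<^esub> mpoly_const c)"

definition trunc_monom :: "nat \<Rightarrow> nat \<Rightarrow> (nat \<Rightarrow> nat) \<Rightarrow> ('f::field) mpoly set" where
  "trunc_monom q n a =
    (\<Otimes>\<^bsub>trunc_ring q n\<^esub> j \<in> {1..n}. trunc_var q n j [^]\<^bsub>trunc_ring q n\<^esub> a j)"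

text \<open>
  The library's \<open>subalgebra\<close> does not require closure under multiplication or containment
  of the unit; both come from \<open>subring\<close>.
\<close>

definition generated_subalgebra :: "'a set \<Rightarrow> ('a, 'b) ring_scheme \<Rightarrow> 'a set \<Rightarrow> 'a set" where
  "generated_subalgebra K R S = \<Inter>{B. subring B R \<and> subalgebra K B R \<and> S \<subseteq> B}"

definition monomial_algebra :: "nat \<Rightarrow> nat \<Rightarrow> nat \<Rightarrow> ('f::field) mpoly set ring" where
  "monomial_algebra q n e =
    (trunc_ring q n)
      \<lparr>carrier := generated_subalgebra (trunc_scalars q n) (trunc_ring q n)
         (trunc_monom q n ` {a. [(\<Sum>j = 1..n. q ^ (j - 1) * a j) = 0] (mod e)})\<rparr>"

text \<open>
  For commutative rings only. The intersection with the carrier matters only for the zero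
  ring, which has no maximal ideals.
\<close>

definition jacobson_radical :: "('a, 'b) ring_scheme \<Rightarrow> 'a set" where
  "jacobson_radical R = carrier R \<inter> \<Inter>{M. maximalideal M R}"

text \<open>
  Powers are taken in the monoid of ideals, whose unit is the whole ring, so the zeroth power
  of the radical is the carrier. The minimum exists exactly when the radical is nilpotent, as
  it is for every finite-dimensional algebra.
\<close>

definition loewy_length :: "('a, 'b) ring_scheme \<Rightarrow> nat" where
  "loewy_length R = (LEAST l. jacobson_radical R [^]\<^bsub>ideals_set R\<^esub> (l :: nat) = {\<zero>\<^bsub>R\<^esub>})"

text \<open>The following lemmas record that the objects above are commutative rings.\<close>

lemma cring_mpoly_ring: "cring (mpoly_ring n :: ('f::field) mpoly ring)"
proof -
  let ?P = "mpoly_ring n :: 'f mpoly ring"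
  have mult: "p * r \<in> carrier ?P" if "p \<in> carrier ?P" "r \<in> carrier ?P" for p r
  proof -
    have "Poly_Mapping.keys v \<subseteq> {1..n}" if v: "v \<in> Poly_Mapping.keys (p * r)" for v
    proof -
      obtain a b where "a \<in> Poly_Mapping.keys p" "b \<in> Poly_Mapping.keys r" "v = a + b"
        using v keys_mult[of p r] by blast
      then show ?thesis
        using \<open>p \<in> carrier ?P\<close> \<open>r \<in> carrier ?P\<close> Poly_Mapping.keys_add[of a b]
        unfolding mpoly_ring_def by fastforce
    qed
    then show ?thesis by (simp add: mpoly_ring_def)
  qed
  have add: "p + r \<in> carrier ?P" if "p \<in> carrier ?P" "r \<in> carrier ?P" for p r
    using that Poly_Mapping.keys_add[of p r] unfolding mpoly_ring_def by fastforce
  have neg: "- p \<in> carrier ?P" if "p \<in> carrier ?P" for p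
    using that by (simp add: mpoly_ring_def)
  have sel: "x \<otimes>\<^bsub>?P\<^esub> y = x * y" "\<one>\<^bsub>?P\<^esub> = 1" "x \<oplus>\<^bsub>?P\<^esub> y = x + y" "\<zero>\<^bsub>?P\<^esub> = 0"
    for x y :: "'f mpoly"
    by (simp_all add: mpoly_ring_def)
  have one: "1 \<in> carrier ?P" and zero: "0 \<in> carrier ?P"
    by (simp_all add: mpoly_ring_def)
  show ?thesis
  proof (rule cringI)
    show "abelian_group ?P"
    proof (rule abelian_groupI)
      show "\<exists>y \<in> carrier ?P. y \<oplus>\<^bsub>?P\<^esub> x = \<zero>\<^bsub>?P\<^esub>" if "x \<in> carrier ?P" for x
        using neg[OF that] by (intro bexI[of _ "- x"]) (simp_all add: sel)
    qed (simp_all add: sel add zero add_ac)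
    show "Group.comm_monoid ?P"
      by (rule comm_monoidI) (simp_all add: sel mult one mult_ac)
  qed (simp add: sel distrib_right)
qed

lemma mpoly_var_in_carrier: "j \<in> {1..n} \<Longrightarrow> mpoly_var j \<in> carrier (mpoly_ring n)"
  by (auto simp: mpoly_ring_def mpoly_var_def)

lemma mpoly_const_in_carrier: "mpoly_const c \<in> carrier (mpoly_ring n)"
  by (auto simp: mpoly_ring_def mpoly_const_def)

lemma ideal_trunc_ideal: "ideal (trunc_ideal q n :: ('f::field) mpoly set) (mpoly_ring n)"
proof -
  interpret P: cring "mpoly_ring n :: 'f mpoly ring" by (rule cring_mpoly_ring)
  show ?thesis
    unfolding trunc_ideal_def using mpoly_var_in_carrier by (intro P.genideal_ideal) blast
qed

lemma cring_trunc_ring: "cring (trunc_ring q n :: ('f::field) mpoly set ring)"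
  unfolding trunc_ring_def
  by (rule ideal.quotient_is_cring[OF ideal_trunc_ideal cring_mpoly_ring])

lemma coset_in_trunc_ring:
  "p \<in> carrier (mpoly_ring n) \<Longrightarrow>
    trunc_ideal q n +>\<^bsub>mpoly_ring n\<^esub> p \<in> carrier (trunc_ring q n)"
  by (auto simp: trunc_ring_def FactRing_def A_RCOSETS_def')

lemma trunc_monom_in_carrier:
  "trunc_monom q n a \<in> carrier (trunc_ring q n :: ('f::field) mpoly set ring)"
proof -
  interpret Q: cring "trunc_ring q n :: 'f mpoly set ring" by (rule cring_trunc_ring)
  show ?thesis
    unfolding trunc_monom_def trunc_var_def
    by (intro Q.finprod_closed) (auto intro!: coset_in_trunc_ring mpoly_var_in_carrier)
qed

lemma cring_monomial_algebra: "cring (monomial_algebra q n e :: ('f::field) mpoly set ring)"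
proof -
  interpret Q: cring "trunc_ring q n :: 'f mpoly set ring" by (rule cring_trunc_ring)
  let ?M = "trunc_monom q n ` {a. [(\<Sum>j = 1..n. q ^ (j - 1) * a j) = 0] (mod e)}
    :: 'f mpoly set set"
  let ?F = "{B. subring B (trunc_ring q n) \<and> subalgebra (trunc_scalars q n) B (trunc_ring q n)
    \<and> ?M \<subseteq> B}"
  have "trunc_scalars q n \<subseteq> carrier (trunc_ring q n :: 'f mpoly set ring)"
    by (auto simp: trunc_scalars_def intro!: coset_in_trunc_ring mpoly_const_in_carrier)
  then have "carrier (trunc_ring q n) \<in> ?F"
    using Q.carrier_is_subring Q.carrier_is_subalgebra trunc_monom_in_carrier by blast
  then have "subring (\<Inter>?F) (trunc_ring q n)"
    by (intro Q.subring_Inter) auto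
  then have "subcring (\<Inter>?F) (trunc_ring q n)" and "\<Inter>?F \<subseteq> carrier (trunc_ring q n)"
    by (blast intro: Q.subcringI', blast dest: subringE(1))
  then show ?thesis
    unfolding monomial_algebra_def generated_subalgebra_def using Q.subcring_iff by blast
qed

end

theory Submission
  imports Defs "HOL-Number_Theory.Number_Theory"
begin

text \<open>
  Only exponent vectors matter. The radical is spanned by the nontrivial monomials of $A(q,n,e)$,
  each of degree at least $m$, whereas a nonzero monomial has degree at most $n(q-1)$; so the formula
  holds as soon as $m \mid n(q-1)$ and the vector $(q-1, \dots, q-1)$ is a sum of $n(q-1)/m$ exponent
  vectors of nontrivial monomials in $A(q,n,e)$.

  Let $d = \gcd(q-1, e)$, $k = e/d$ and let $o$ be the order of $q$ modulo $e$. Then $d \mid m$, and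
  $m \le d\,o$ because $e$ divides $d(1 + q + \dots + q^{o-1})$. Hence $m \ge e/3$ makes
  $A = \{(q^i-1)/d\} \subseteq \mathbb{Z}/k$ a generating set with $|A| = o \ge k/3$ and $0 \in A$. By the
  $3/2$ theorem on small doubling, $A+A+A+A+A = \mathbb{Z}/k$, so $m \le t$ for every positive multiple
  $t \ge 5$ of $d$. If $k \ge 4$ this leaves only $e \le 24$ and, after a finite check, eight pairs
  $(e, q \bmod e)$; if $k \le 3$ it gives $m = d \mid q - 1$ except for $e = 3$, $q \equiv 2$.
  When $m \mid q - 1$ the cyclic shifts of a minimal sum split the vector, and in the exceptional cases
  the exponents are tiled by arithmetic progressions.
\<close>

section \<open>Sumsets in finite abelian groups\<close>

text \<open>Why five summands: pigeonhole fills a finite group with a product set as soon as the two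
  sizes add up to more than the order. Without small doubling, |A+A| >= (3/2)|A| >= k/2, and this
  may be exactly half, so pigeonhole can just fail for (A+A)+(A+A). In that equality case A+A is not
  stable under adding A, because A generates; hence A+A+A is strictly larger, and (A+A+A)+(A+A)
  works. Why multiples of d: since 0 lies in A, five summands can be padded to any number of terms,
  and divisibility by d is the only constraint left on that number. On the algebra side the radical
  is only enclosed: a single maximal ideal bounds it from above, and nilpotent monomials, which lie
  in every maximal ideal, bound it from below. The two bounds meet because m divides n(q-1)
  exactly.\<close>

lemma (in group) set_mult_eq_carrier:
  assumes fin: "finite (carrier G)" and A: "A \<subseteq> carrier G" and B: "B \<subseteq> carrier G"
    and large: "order G < card A + card B"
  shows "A <#> B = carrier G"
proof
  show "A <#> B \<subseteq> carrier G" by (rule set_mult_closed[OF A B])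
  show "carrier G \<subseteq> A <#> B"
  proof
    fix x assume x: "x \<in> carrier G"
    \<comment> \<open>Pigeonhole: the set of all x b^-1 has as many elements as \<open>B\<close>, so
      it cannot avoid \<open>A\<close>; a common element yields a factorization of
      \<open>x\<close>.\<close>
    have "inj_on (\<lambda>b. x \<otimes> inv b) B"
      using x B by (intro inj_onI) (metis inv_closed inv_inv l_cancel subsetD)
    then have "card ((\<lambda>b. x \<otimes> inv b) ` B) = card B" by (rule card_image)
    moreover have sub: "(\<lambda>b. x \<otimes> inv b) ` B \<subseteq> carrier G" using x B by auto
    ultimately have "A \<inter> (\<lambda>b. x \<otimes> inv b) ` B \<noteq> {}"
      using large card_Un_disjoint[of A "(\<lambda>b. x \<otimes> inv b) ` B"] fin A
        card_mono[OF fin, of "A \<union> (\<lambda>b. x \<otimes> inv b) ` B"]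
      by (auto simp: order_def finite_subset)
    then obtain b where b: "b \<in> B" "x \<otimes> inv b \<in> A" by auto
    then have "x = (x \<otimes> inv b) \<otimes> b" using x B by (metis inv_solve_right' subsetD inv_closed m_closed)
    then show "x \<in> A <#> B" using b unfolding set_mult_def by blast
  qed
qed

text \<open>
  If $|AA| < \frac32 |A|$, the elements with more than $|A|/2$ representations as quotients of
  elements of \<open>A\<close> form a subgroup.
\<close>

lemma (in comm_group) order_less_if_small_doubling:
  assumes fin: "finite (carrier G)" and A: "A \<subseteq> carrier G" and one: "\<one> \<in> A"
    and gen: "generate G A = carrier G" and small: "2 * card (A <#> A) < 3 * card A"
  shows "order G < 2 * card A"
proof -
  define R where "R x = {b \<in> A. x \<otimes> b \<in> A}" for x
  define D where "D = {x \<in> carrier G. card A < 2 * card (R x)}"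
  have finA: "finite A" using A fin finite_subset by blast
  have finR: "finite (R x)" for x using finA by (simp add: R_def)
  have finAA: "finite (A <#> A)" using set_mult_closed[OF A A] fin finite_subset by blast
  \<comment> \<open>The translates of \<open>A\<close> by \<open>a\<close> and by \<open>b\<close>
    both lie in \<open>A <#> A\<close>, which is so small that they share more than half of their
    elements; each shared element gives a representation of the quotient.\<close>
  have quot: "a \<otimes> inv b \<in> D" if ab: "a \<in> A" "b \<in> A" for a b
  proof -
    have c: "a \<in> carrier G" "b \<in> carrier G" using ab A by auto
    have card_trans: "card ((\<lambda>x. y \<otimes> x) ` A) = card A" if "y \<in> carrier G" for y
      using that A by (intro card_image inj_onI) (metis l_cancel subsetD)
    have "(\<lambda>x. a \<otimes> x) ` A \<union> (\<lambda>x. b \<otimes> x) ` A \<subseteq> A <#> A"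
      using ab by (auto simp: set_mult_def)
    then have "card ((\<lambda>x. a \<otimes> x) ` A \<union> (\<lambda>x. b \<otimes> x) ` A) \<le> card (A <#> A)"
      by (intro card_mono finAA)
    then have "2 * card A \<le> card (A <#> A) + card ((\<lambda>x. a \<otimes> x) ` A \<inter> (\<lambda>x. b \<otimes> x) ` A)"
      using card_Un_Int[of "(\<lambda>x. a \<otimes> x) ` A" "(\<lambda>x. b \<otimes> x) ` A"] card_trans c finA by simp
    moreover have "(\<lambda>x. a \<otimes> x) ` A \<inter> (\<lambda>x. b \<otimes> x) ` A \<subseteq> (\<lambda>x. a \<otimes> x) ` R (a \<otimes> inv b)"
    proof
      fix z assume "z \<in> (\<lambda>x. a \<otimes> x) ` A \<inter> (\<lambda>x. b \<otimes> x) ` A"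
      then obtain x y where z: "x \<in> A" "y \<in> A" "z = a \<otimes> x" "z = b \<otimes> y" by auto
      then have xy: "x \<in> carrier G" "y \<in> carrier G" using A by auto
      have "(a \<otimes> inv b) \<otimes> x = inv b \<otimes> (a \<otimes> x)" using c xy by (simp add: m_ac)
      also have "\<dots> = inv b \<otimes> (b \<otimes> y)" using z by simp
      also have "\<dots> = y" using c xy by (simp add: m_assoc[symmetric])
      finally show "z \<in> (\<lambda>x. a \<otimes> x) ` R (a \<otimes> inv b)" using z by (auto simp: R_def)
    qed
    then have "card ((\<lambda>x. a \<otimes> x) ` A \<inter> (\<lambda>x. b \<otimes> x) ` A) \<le> card (R (a \<otimes> inv b))"
      using finR by (intro order.trans[OF card_mono card_image_le]) auto
    ultimately have "card A < 2 * card (R (a \<otimes> inv b))" using small by linarith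
    then show ?thesis using c by (simp add: D_def)
  qed
  have "subgroup D G"
  proof (rule subgroupI)
    show "D \<subseteq> carrier G" by (auto simp: D_def)
    show "D \<noteq> {}" using quot[OF one one] by auto
    have div: "x \<otimes> inv y \<in> D" if xy: "x \<in> D" "y \<in> D" for x y
    proof -
      have c: "x \<in> carrier G" "y \<in> carrier G" using xy by (auto simp: D_def)
      \<comment> \<open>\<open>R x\<close> and \<open>R y\<close> each fill more than half of
        \<open>A\<close>, so they meet. A common \<open>b\<close> rewrites x y^-1 as a quotient of
        two elements of \<open>A\<close>, to which \<open>quot\<close> applies.\<close>
      have "R x \<inter> R y \<noteq> {}"
      proof
        assume "R x \<inter> R y = {}"
        then have "card (R x) + card (R y) = card (R x \<union> R y)"
          using finA by (simp add: card_Un_disjoint R_def)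
        also have "\<dots> \<le> card A" using finA by (intro card_mono) (auto simp: R_def)
        finally show False using xy by (simp add: D_def)
      qed
      then obtain b where b: "b \<in> A" "x \<otimes> b \<in> A" "y \<otimes> b \<in> A" by (auto simp: R_def)
      then have bc: "b \<in> carrier G" using A by auto
      have "(x \<otimes> b) \<otimes> inv (y \<otimes> b) = x \<otimes> (b \<otimes> (inv b \<otimes> inv y))"
        using c bc by (simp add: inv_mult_group m_assoc)
      also have "\<dots> = x \<otimes> inv y" using c bc by (simp add: m_assoc[symmetric])
      finally have "(x \<otimes> b) \<otimes> inv (y \<otimes> b) = x \<otimes> inv y" .
      then show ?thesis using quot[OF b(2,3)] by simp
    qed
    have oneD: "\<one> \<in> D" using quot[OF one one] A one by auto
    show inv: "inv a \<in> D" if "a \<in> D" for a using div[OF oneD that] that by (auto simp: D_def)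
    show "a \<otimes> b \<in> D" if "a \<in> D" "b \<in> D" for a b
      using div[OF that(1) inv[OF that(2)]] that by (auto simp: D_def)
  qed
  moreover have "A \<subseteq> D"
  proof
    fix a assume a: "a \<in> A"
    then have "a \<in> carrier G" using A by auto
    then show "a \<in> D" using quot[OF a one] by simp
  qed
  ultimately have "carrier G \<subseteq> D" using gen generate_subgroup_incl by blast
  \<comment> \<open>Double counting of the pairs (x, b) with b and x b in \<open>A\<close>: every x
    in the group has more than |A|/2 of them, while each b admits at most |A|.\<close>
  then have "(\<Sum>x\<in>carrier G. card A) < (\<Sum>x\<in>carrier G. 2 * card (R x))"
    using fin one_closed by (intro sum_strict_mono) (auto simp: D_def)
  also have "\<dots> = 2 * (\<Sum>x\<in>carrier G. \<Sum>b\<in>A. if x \<otimes> b \<in> A then 1 else 0)"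
    unfolding sum_distrib_left[symmetric] R_def using finA
    by (intro arg_cong[where f = "\<lambda>s. 2 * s"] sum.cong refl) (simp add: sum.If_cases Int_def)
  also have "(\<Sum>x\<in>carrier G. \<Sum>b\<in>A. if x \<otimes> b \<in> A then 1 else 0)
      = (\<Sum>b\<in>A. \<Sum>x\<in>carrier G. if x \<otimes> b \<in> A then 1 else 0)" by (rule sum.swap)
  also have "\<dots> \<le> (\<Sum>b\<in>A. card A)"
  proof (rule sum_mono)
    fix b assume b: "b \<in> A"
    have "(\<Sum>x\<in>carrier G. if x \<otimes> b \<in> A then 1 else 0) = card {x \<in> carrier G. x \<otimes> b \<in> A}"
      using fin by (simp add: sum.If_cases Int_def)
    also have "\<dots> \<le> card A"
    proof (rule card_inj_on_le[OF _ _ finA])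
      show "inj_on (\<lambda>x. x \<otimes> b) {x \<in> carrier G. x \<otimes> b \<in> A}"
        using b A by (auto intro!: inj_onI)
    qed auto
    finally show "(\<Sum>x\<in>carrier G. if x \<otimes> b \<in> A then 1 else 0) \<le> card A" .
  qed
  finally show ?thesis using one finA by (auto simp: order_def)
qed

text \<open>The right multipliers that preserve \<open>S\<close> form a subgroup \<open>T\<close>,
  closed under inverses because an injective self-map of the finite set \<open>S\<close> is onto. It
  contains the generators. The lemma serves to force strict growth of the products of
  \<open>A\<close>.\<close>

lemma (in group) eq_carrier_if_set_mult_subset:
  assumes fin: "finite (carrier G)" and gen: "generate G A = carrier G" and A: "A \<subseteq> carrier G"
    and S: "S \<subseteq> carrier G" "S \<noteq> {}" and stable: "S <#> A \<subseteq> S"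
  shows "S = carrier G"
proof -
  define T where "T = {x \<in> carrier G. \<forall>s\<in>S. s \<otimes> x \<in> S}"
  have finS: "finite S" using S fin finite_subset by blast
  have "subgroup T G"
  proof (rule subgroupI)
    show "T \<subseteq> carrier G" by (auto simp: T_def)
    show "T \<noteq> {}" using S by (auto simp: T_def intro!: exI[of _ \<one>])
    show "inv x \<in> T" if x: "x \<in> T" for x
    proof -
      have xc: "x \<in> carrier G" using x by (simp add: T_def)
      have "inj_on (\<lambda>s. s \<otimes> x) S"
        using xc S by (intro inj_onI) (metis r_cancel subsetD)
      then have img: "(\<lambda>s. s \<otimes> x) ` S = S"
        using x by (intro endo_inj_surj finS) (auto simp: T_def)
      have "s \<otimes> inv x \<in> S" if "s \<in> S" for s
      proof -
        have "s \<in> (\<lambda>s. s \<otimes> x) ` S" using that img by (simp only:)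
        then obtain t where "s = t \<otimes> x" "t \<in> S" by (rule imageE)
        moreover have "t \<in> carrier G" using S \<open>t \<in> S\<close> by auto
        ultimately show ?thesis using xc by (simp add: m_assoc)
      qed
      then show ?thesis using xc by (simp add: T_def)
    qed
    show "x \<otimes> y \<in> T" if "x \<in> T" "y \<in> T" for x y
      using that S by (auto simp: T_def m_assoc[symmetric] dest: subsetD)
  qed
  moreover have "A \<subseteq> T" using A stable by (auto simp: T_def set_mult_def)
  ultimately have T: "carrier G \<subseteq> T" using gen generate_subgroup_incl by blast
  obtain s where s: "s \<in> S" using S by auto
  have "y \<in> S" if y: "y \<in> carrier G" for y
  proof -
    have sc: "s \<in> carrier G" using s S by auto
    then have "inv s \<otimes> y \<in> T" using T y by (meson inv_closed m_closed subsetD)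
    then have "s \<otimes> (inv s \<otimes> y) \<in> S" using s by (simp add: T_def)
    then show ?thesis using sc y by (simp add: m_assoc[symmetric])
  qed
  then show ?thesis using S by auto
qed

lemma (in group) subset_set_mult_one:
  assumes "S \<subseteq> carrier G" "\<one> \<in> A" shows "S \<subseteq> S <#> A"
proof
  fix s assume s: "s \<in> S"
  then have "s \<otimes> \<one> \<in> S <#> A" using assms unfolding set_mult_def by blast
  moreover have "s \<in> carrier G" using s assms by auto
  ultimately show "s \<in> S <#> A" by simp
qed

lemma (in comm_group) fivefold_set_mult_eq_carrier:
  assumes fin: "finite (carrier G)" and A: "A \<subseteq> carrier G" and one: "\<one> \<in> A"
    and gen: "generate G A = carrier G" and large: "order G \<le> 3 * card A"
  shows "A <#> A <#> A <#> (A <#> A) = carrier G"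
proof -
  have AA: "A <#> A \<subseteq> carrier G" by (rule set_mult_closed[OF A A])
  have AAA: "A <#> A <#> A \<subseteq> carrier G" by (rule set_mult_closed[OF AA A])
  have sub: "A \<subseteq> A <#> A" by (rule subset_set_mult_one[OF A one])
  have sub2: "A <#> A \<subseteq> A <#> A <#> A" by (rule subset_set_mult_one[OF AA one])
  have finS: "finite S" if "S \<subseteq> carrier G" for S using that fin finite_subset by blast
  show ?thesis
  proof (cases "order G < 2 * card (A <#> A)")
    case True
    then show ?thesis
      using card_mono[OF finS[OF AAA] sub2] by (intro set_mult_eq_carrier[OF fin AAA AA]) linarith
  next
    case False
    have "order G < 2 * card A" if "2 * card (A <#> A) < 3 * card A"
      using that by (rule order_less_if_small_doubling[OF fin A one gen])
    \<comment> \<open>Small doubling would make \<open>A\<close> alone exceed half of the group, so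
      2|AA| >= 3|A| >= |G|. With the case assumption, \<open>A <#> A\<close> is exactly
      half.\<close>
    then have eq: "order G = 2 * card (A <#> A)"
      using False large card_mono[OF finS[OF AA] sub] by linarith
    have "A <#> A <#> A \<noteq> A <#> A"
    proof
      assume "A <#> A <#> A = A <#> A"
      then have "A <#> A = carrier G"
        using eq_carrier_if_set_mult_subset[OF fin gen A AA] sub one by blast
      then show False using eq order_gt_0_iff_finite fin by (simp add: order_def)
    qed
    then have "card (A <#> A) < card (A <#> A <#> A)"
      using sub2 by (intro psubset_card_mono finS AAA) auto
    then show ?thesis using eq by (intro set_mult_eq_carrier[OF fin AAA AA]) linarith
  qed
qed

section \<open>Short sums of powers\<close>

lemma min_power_sum_length_le:
  assumes "ks \<noteq> []" "e dvd (\<Sum>k\<leftarrow>ks. q ^ k)"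
  shows "min_power_sum_length q e \<le> length ks"
  unfolding min_power_sum_length_def using assms by (intro Least_le) auto

lemma min_power_sum_length_witness:
  assumes "e \<ge> 1"
  obtains ks where "ks \<noteq> []" "length ks = min_power_sum_length q e" "e dvd (\<Sum>k\<leftarrow>ks. q ^ k)"
proof -
  let ?P = "\<lambda>t. 0 < t \<and> (\<exists>ks :: nat list. length ks = t \<and> e dvd (\<Sum>k\<leftarrow>ks. q ^ k))"
  have "?P e" using assms by (auto intro!: exI[of _ "replicate e 0"] simp: sum_list_replicate)
  then have "?P (min_power_sum_length q e)" unfolding min_power_sum_length_def by (rule LeastI)
  then obtain ks :: "nat list" where "0 < min_power_sum_length q e"
    "length ks = min_power_sum_length q e" "e dvd (\<Sum>k\<leftarrow>ks. q ^ k)" by blast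
  then show thesis by (intro that[of ks]) auto
qed

lemma cong_length_power_sum:
  assumes "[q = 1] (mod d)"
  shows "[(\<Sum>k\<leftarrow>ks. q ^ k) = length ks] (mod (d::nat))"
proof (induction ks)
  case (Cons k ks)
  then show ?case using cong_add[OF cong_pow[OF assms, of k] Cons] by simp
qed simp

text \<open>Powers of \<open>q\<close> are 1 modulo \<open>d\<close>, so a sum of them is congruent
  to its number of terms. The divisor \<open>d\<close> is arbitrary because the lemma serves both
  gcd(q - 1, e) and the multiplicity \<open>c\<close> of the exceptional cases.\<close>

lemma dvd_min_power_sum_length:
  assumes "e \<ge> 1" and "d dvd e" and "[q = 1] (mod d)"
  shows "d dvd min_power_sum_length q e"
proof -
  obtain ks where ks: "length ks = min_power_sum_length q e" "e dvd (\<Sum>k\<leftarrow>ks. q ^ k)"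
    using min_power_sum_length_witness[OF assms(1)] by metis
  then have "d dvd (\<Sum>k\<leftarrow>ks. q ^ k)" using assms dvd_trans by blast
  then show ?thesis using cong_dvd_iff[OF cong_length_power_sum[OF assms(3), of ks]] ks by simp
qed

section \<open>Power sums modulo e as sums in Z/k\<close>

locale coprime_base =
  fixes q e d k :: nat
  assumes q: "q > 1" and e: "e \<ge> 1" and coprime: "coprime q e"
    and d_def: "d = gcd (q - 1) e" and k_def: "k = e div d"
begin

lemma e_eq: "e = d * k" and d_pos: "d > 0" and k_pos: "k > 0"
proof -
  show "e = d * k" by (simp add: d_def k_def)
  then show "d > 0" "k > 0" using e by (auto intro: Nat.gr0I)
qed

lemma d_dvd: "d dvd q - 1" by (simp add: d_def)

lemma q_cong: "[q = 1] (mod d)"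
  using d_dvd q by (simp add: cong_altdef_nat)

lemma d_dvd_power: "d dvd q ^ i - 1"
  using cong_pow[OF q_cong, of i] q by (simp add: cong_altdef_nat)

lemma coprime_quot: "coprime ((q - 1) div d) k"
  unfolding k_def d_def using e by (intro div_gcd_coprime) auto

text \<open>
  Writing $q^i = 1 + d\,a_i$, a sum of $t$ powers of $q$ with $d \mid t$ is divisible by $e = dk$
  iff the sum of the $a_i$ is $-t/d$ modulo $k$.
\<close>

definition reduced_powers :: "int set" where
  "reduced_powers = range (\<lambda>i. int ((q ^ i - 1) div d) mod int k)"

text \<open>Cancelling \<open>d\<close> in e | (q - 1)(1 + q + ... + q^(o-1)) leaves the factor (q -
  1)/d, which is coprime to \<open>k\<close>; so \<open>k\<close> divides the geometric sum, and
  \<open>d\<close> copies of it are divisible by \<open>e\<close>.\<close>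

lemma min_le_mult_ord: "min_power_sum_length q e \<le> d * ord e q"
proof -
  define ks where "ks = concat (replicate d [0..< ord e q])"
  have pos: "ord e q > 0" using coprime by (simp add: coprime_commute)
  have sum: "(\<Sum>i\<leftarrow>ks. q ^ i) = d * (\<Sum>i < ord e q. q ^ i)"
    unfolding ks_def by (induction d) (simp_all add: sum_list_distinct_conv_sum_set atLeast0LessThan)
  have "e dvd q ^ ord e q - 1"
    using ord[of q e] q by (simp add: cong_altdef_nat)
  also have "q ^ ord e q - 1 = (q - 1) * (\<Sum>i < ord e q. q ^ i)"
  proof -
    have "int (q ^ ord e q - 1) = int q ^ ord e q - 1" using q by simp
    also have "\<dots> = (int q - 1) * (\<Sum>i < ord e q. int q ^ i)" by (rule power_diff_1_eq)
    also have "\<dots> = int ((q - 1) * (\<Sum>i < ord e q. q ^ i))" using q by simp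
    finally show ?thesis by linarith
  qed
  also have "\<dots> = d * ((q - 1) div d * (\<Sum>i < ord e q. q ^ i))"
    using d_dvd by simp
  finally have "k dvd (q - 1) div d * (\<Sum>i < ord e q. q ^ i)"
    using d_pos unfolding e_eq by simp
  then have "k dvd (\<Sum>i < ord e q. q ^ i)"
    using coprime_quot by (simp add: coprime_dvd_mult_right_iff coprime_commute)
  then have "e dvd (\<Sum>i\<leftarrow>ks. q ^ i)" unfolding sum e_eq by simp
  moreover have "length ks = d * ord e q"
    unfolding ks_def by (induction d) simp_all
  moreover have "ks \<noteq> []" using calculation(2) pos d_pos
    by (metis length_0_conv mult_pos_pos less_numeral_extra(3))
  ultimately show ?thesis using min_power_sum_length_le by metis
qed

text \<open>Multiplication by \<open>d\<close> turns congruence modulo \<open>k\<close> into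
  congruence modulo \<open>d * k = e\<close>, so (q^i - 1)/d modulo \<open>k\<close> determines q^i
  modulo \<open>e\<close>, and these are distinct for i below the order.\<close>

lemma ord_le_card_reduced_powers: "ord e q \<le> card reduced_powers"
proof -
  have "inj_on (\<lambda>i. int ((q ^ i - 1) div d) mod int k) {..< ord e q}"
  proof (rule inj_onI)
    fix i j assume ij: "i \<in> {..< ord e q}" "j \<in> {..< ord e q}"
      and eq: "int ((q ^ i - 1) div d) mod int k = int ((q ^ j - 1) div d) mod int k"
    then have "[(q ^ i - 1) div d = (q ^ j - 1) div d] (mod k)"
      by (simp add: cong_int_iff[symmetric] cong_def)
    then have "[d * ((q ^ i - 1) div d) = d * ((q ^ j - 1) div d)] (mod d * k)"
      by (simp add: cong_def mod_mult_mult1)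
    then have "[q ^ i - 1 = q ^ j - 1] (mod e)"
      using d_dvd_power by (simp add: e_eq[symmetric])
    then have "[q ^ i - 1 + 1 = q ^ j - 1 + 1] (mod e)" by (intro cong_add cong_refl)
    then have "[q ^ i = q ^ j] (mod e)" using q by simp
    then have "[i = j] (mod ord e q)"
      using coprime order_divides_expdiff[of e q i j] by (simp add: coprime_commute)
    then show "i = j" using ij by (simp add: cong_def)
  qed
  then have "card {..< ord e q} = card ((\<lambda>i. int ((q ^ i - 1) div d) mod int k) ` {..< ord e q})"
    by (simp add: card_image)
  also have "\<dots> \<le> card reduced_powers"
  proof (rule card_mono)
    have "reduced_powers \<subseteq> {0..<int k}" unfolding reduced_powers_def using k_pos by auto
    then show "finite reduced_powers" using finite_subset by blast
  qed (auto simp: reduced_powers_def)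
  finally show ?thesis by simp
qed

abbreviation Zk where "Zk \<equiv> integer_mod_group k"

lemma carrier_Zk: "carrier Zk = {0..<int k}"
  using k_pos by (simp add: carrier_integer_mod_group)

lemma reduced_powers_closed: "reduced_powers \<subseteq> carrier Zk"
  unfolding reduced_powers_def carrier_Zk using k_pos by auto

lemma zero_in_reduced_powers: "0 \<in> reduced_powers"
  unfolding reduced_powers_def by (rule image_eqI[of _ _ 0]) simp_all

text \<open>The single element belonging to i = 1 already generates, since (q - 1)/d is a unit
  modulo \<open>k\<close>.\<close>

lemma generate_reduced_powers: "generate Zk reduced_powers = carrier Zk"
proof
  show "generate Zk reduced_powers \<subseteq> carrier Zk"
    by (rule group.generate_incl[OF group_integer_mod_group reduced_powers_closed])
  show "carrier Zk \<subseteq> generate Zk reduced_powers"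
  proof
    fix y assume "y \<in> carrier Zk"
    then have y: "0 \<le> y" "y < int k" by (simp_all add: carrier_Zk)
    interpret Z: group Zk by simp
    have sub: "subgroup (generate Zk reduced_powers) Zk"
      by (rule Z.generate_is_subgroup[OF reduced_powers_closed])
    have pow: "x [^]\<^bsub>Zk\<^esub> i \<in> generate Zk reduced_powers"
      if "x \<in> generate Zk reduced_powers" for x and i :: nat
      using subgroup.one_closed[OF sub] subgroup.m_closed[OF sub _ that]
      by (induction i) (simp_all del: pow_integer_mod_group one_integer_mod_group mult_integer_mod_group)
    let ?u = "int ((q - 1) div d)"
    obtain x where "[?u * x = 1] (mod int k)"
      using coprime_quot cong_solve_coprime_int[of ?u "int k"] by auto
    then have "[nat (x * y mod int k) * ?u = y] (mod int k)"
      using k_pos by (auto simp: cong_def mod_mult_left_eq mod_mult_right_eq)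
        (metis mod_mult_left_eq mult.assoc mult.commute mult_1)
    then have "(?u mod int k) [^]\<^bsub>Zk\<^esub> nat (x * y mod int k) = y" using y
      by (simp add: cong_def mod_mult_right_eq)
    moreover have "?u mod int k \<in> generate Zk reduced_powers"
      by (rule generate.incl) (auto simp: reduced_powers_def intro: image_eqI[of _ _ 1])
    ultimately show "y \<in> generate Zk reduced_powers"
      using pow by metis
  qed
qed

end

text \<open>The pair (3, 2) comes from the case k <= 3, the other eight from the finite check.
  Membership depends only on \<open>q\<close> modulo \<open>e\<close>, so m may still divide q - 1,
  as for e = 5 and q = 7.\<close>

definition exceptional_residues :: "(nat \<times> nat) set" where
  "exceptional_residues =
    {(3, 2), (5, 2), (5, 3), (5, 4), (7, 2), (7, 4), (8, 3), (15, 4), (24, 5)}"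

text \<open>
  For $e \le 24$ with $k = e / d \ge 4$ outside the exceptional list, a divisible sum
  $w + x q + y q^2 + z q^3$ with fewer than $e/3$ terms can be chosen from the following
  multiplicities $(w, x, y, z)$, found by a greedy search.
\<close>

definition candidate_multiplicities :: "(int \<times> int \<times> int \<times> int) list" where
  "candidate_multiplicities =
    [(1, 0, 0, 1), (1, 1, 1, 1), (4, 0, 1, 1), (0, 0, 1, 2), (1, 0, 1, 2), (1, 1, 0, 2),
     (0, 1, 0, 2), (1, 2, 2, 1), (0, 2, 0, 1), (0, 1, 1, 2), (0, 2, 1, 2), (0, 2, 1, 1),
     (2, 1, 1, 2), (0, 0, 2, 1), (1, 0, 1, 1), (1, 1, 0, 1), (0, 1, 0, 1), (0, 1, 1, 1),
     (1, 0, 2, 1), (1, 2, 0, 1), (2, 0, 1, 1), (1, 1, 1, 2), (2, 1, 1, 1)]"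

text \<open>The check runs over the integers; nonnegativity turns its multiplicities back into
  naturals, which become lengths of lists of exponents.\<close>

lemma candidate_multiplicities_nonneg:
  "\<forall>(w, x, y, z) \<in> set candidate_multiplicities.
    0 \<le> w \<and> 0 \<le> x \<and> 0 \<le> y \<and> 0 \<le> z \<and> 0 < w + x + y + z"
  by code_simp

lemma short_zero_sum_small_modulus:
  "\<forall>e \<in> set [4..24]. \<forall>g \<in> set [1..e - 1]. gcd g e = 1 \<and> 4 \<le> e div gcd (g - 1) e \<longrightarrow>
    (e, g) \<in> set [(5, 2), (5, 3), (5, 4), (7, 2), (7, 4), (8, 3), (15, 4), (24, 5)] \<or>
    (\<exists>(w, x, y, z) \<in> set candidate_multiplicities. 3 * (w + x + y + z) < e \<and>
      (w + x * g + y * g ^ 2 + z * g ^ 3) mod e = 0)"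
  by code_simp

section \<open>Upper bounds for m and the classification of large m\<close>

context coprime_base
begin

definition power_sums :: "nat \<Rightarrow> int set" where
  "power_sums j = {int (\<Sum>i\<leftarrow>is. (q ^ i - 1) div d) mod int k | is. length is = j}"

lemma reduced_powers_subset: "reduced_powers \<subseteq> power_sums 1"
proof
  fix x assume "x \<in> reduced_powers"
  then obtain i where "x = int ((q ^ i - 1) div d) mod int k"
    unfolding reduced_powers_def by blast
  then have "x = int (\<Sum>i\<leftarrow>[i]. (q ^ i - 1) div d) mod int k \<and> length [i] = 1" by simp
  then show "x \<in> power_sums 1" unfolding power_sums_def by blast
qed

lemma power_sums_add: "power_sums i <#>\<^bsub>Zk\<^esub> power_sums j \<subseteq> power_sums (i + j)"
proof
  fix x assume "x \<in> power_sums i <#>\<^bsub>Zk\<^esub> power_sums j"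
  then obtain as bs where "length as = i" "length bs = j" and
    x: "x = (int (\<Sum>a\<leftarrow>as. (q ^ a - 1) div d) mod int k
      + int (\<Sum>b\<leftarrow>bs. (q ^ b - 1) div d) mod int k) mod int k"
    unfolding set_mult_def power_sums_def by auto
  moreover have "x = int (\<Sum>a\<leftarrow>as @ bs. (q ^ a - 1) div d) mod int k"
    by (simp add: x mod_add_eq)
  ultimately show "x \<in> power_sums (i + j)"
    unfolding power_sums_def by (auto intro!: exI[of _ "as @ bs"])
qed

text \<open>A sum of t powers equals d times (the sum of the a_i plus t/d). Choose \<open>j\<close>
  exponents whose a_i add up to -t/d modulo \<open>k\<close>; the other t - j exponents are 0, with
  a_0 = 0, so they only adjust the number of terms.\<close>

lemma min_le_if_power_sums:
  assumes all: "carrier Zk \<subseteq> power_sums j" and t: "j \<le> t" "d dvd t" "0 < t"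
  shows "min_power_sum_length q e \<le> t"
proof -
  have "(- int (t div d)) mod int k \<in> power_sums j"
    using all k_pos by (auto simp: carrier_Zk)
  then obtain as where as: "length as = j"
    and eq: "(- int (t div d)) mod int k = int (\<Sum>a\<leftarrow>as. (q ^ a - 1) div d) mod int k"
    unfolding power_sums_def by blast
  have "int k dvd int (\<Sum>a\<leftarrow>as. (q ^ a - 1) div d) - (- int (t div d))"
    using eq[symmetric] by (simp only: mod_eq_dvd_iff)
  then have "int k dvd int ((\<Sum>a\<leftarrow>as. (q ^ a - 1) div d) + t div d)"
    by simp
  then have "k dvd (\<Sum>a\<leftarrow>as. (q ^ a - 1) div d) + t div d"
    by (simp only: int_dvd_int_iff)
  then have "e dvd d * ((\<Sum>a\<leftarrow>as. (q ^ a - 1) div d) + t div d)"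
    unfolding e_eq by simp
  also have "d * ((\<Sum>a\<leftarrow>as. (q ^ a - 1) div d) + t div d) = (\<Sum>a\<leftarrow>as. q ^ a - 1) + t"
    using t d_dvd_power by (simp add: distrib_left sum_list_const_mult[symmetric])
  also have "(\<Sum>a\<leftarrow>as. q ^ a - 1) + t = (\<Sum>a\<leftarrow>as @ replicate (t - j) 0. q ^ a)"
  proof -
    have "(\<Sum>a\<leftarrow>as. q ^ a - 1) + length as = (\<Sum>a\<leftarrow>as. q ^ a - 1 + 1)"
      by (simp only: sum_list_addf sum_list_triv) simp
    also have "\<dots> = (\<Sum>a\<leftarrow>as. q ^ a)"
      using q by (intro arg_cong[where f = sum_list] map_cong refl) simp
    finally have "(\<Sum>a\<leftarrow>as. q ^ a - 1) + length as = (\<Sum>a\<leftarrow>as. q ^ a)" .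
    then show ?thesis using as t by (simp add: sum_list_replicate)
  qed
  finally show ?thesis
    using min_power_sum_length_le[of "as @ replicate (t - j) 0" e q] as t by fastforce
qed

lemma carrier_Zk_finite: "finite (carrier Zk)" and order_Zk: "order Zk = k"
  by (simp_all add: carrier_Zk order_def)

lemma set_mult_subset_power_sums:
  assumes "S \<subseteq> power_sums i" "T \<subseteq> power_sums j"
  shows "S <#>\<^bsub>Zk\<^esub> T \<subseteq> power_sums (i + j)"
  using power_sums_add[of i j] assms by (meson mono_set_mult subset_trans)

lemma fivefold_power_sums:
  assumes "k \<le> 3 * card reduced_powers"
  shows "carrier Zk \<subseteq> power_sums 5"
proof -
  interpret Z: comm_group Zk by simp
  note closed = carrier_Zk_finite reduced_powers_closed generate_reduced_powers
  note s1 = reduced_powers_subset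
  note s2 = set_mult_subset_power_sums[OF s1 s1]
  note s5 = set_mult_subset_power_sums[OF set_mult_subset_power_sums[OF s2 s1] s2]
  have "reduced_powers <#>\<^bsub>Zk\<^esub> reduced_powers <#>\<^bsub>Zk\<^esub> reduced_powers
      <#>\<^bsub>Zk\<^esub> (reduced_powers <#>\<^bsub>Zk\<^esub> reduced_powers) = carrier Zk"
    using zero_in_reduced_powers assms
    by (intro Z.fivefold_set_mult_eq_carrier closed) (simp_all add: order_Zk)
  moreover have "1 + 1 + 1 + (1 + 1) = (5 :: nat)" by simp
  ultimately show ?thesis using s5 by (simp only:)
qed

text \<open>For k > 1 the reduced powers contain 0 and the unit (q - 1)/d, and two elements are more
  than half of a group of order at most 3.\<close>

lemma twofold_power_sums:
  assumes "k \<le> 3"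
  shows "carrier Zk \<subseteq> power_sums 2"
proof -
  interpret Z: comm_group Zk by simp
  have fin: "finite reduced_powers"
    using reduced_powers_closed carrier_Zk_finite finite_subset by blast
  have "k < 2 * card reduced_powers"
  proof (cases "k = 1")
    case True
    moreover have "card {0 :: int} \<le> card reduced_powers"
      using zero_in_reduced_powers by (intro card_mono fin) auto
    ultimately show ?thesis by simp
  next
    case False
    define u where "u = int ((q - 1) div d) mod int k"
    have "u \<noteq> 0"
    proof
      assume "u = 0"
      then have "int k dvd int ((q - 1) div d)" unfolding u_def by (rule mod_0_imp_dvd)
      then have "k dvd (q - 1) div d" by (simp only: int_dvd_int_iff)
      then have "k dvd 1" by (rule coprime_common_divisor[OF coprime_quot _ dvd_refl])
      then show False using False by simp
    qed
    moreover have "u \<in> reduced_powers"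
      unfolding reduced_powers_def u_def by (rule image_eqI[of _ _ 1]) simp_all
    ultimately have "card {0, u} \<le> card reduced_powers"
      using zero_in_reduced_powers by (intro card_mono fin) auto
    then show ?thesis using \<open>u \<noteq> 0\<close> assms by simp
  qed
  then have "reduced_powers <#>\<^bsub>Zk\<^esub> reduced_powers = carrier Zk"
    by (intro Z.set_mult_eq_carrier carrier_Zk_finite reduced_powers_closed) (simp add: order_Zk)
  then show ?thesis
    using set_mult_subset_power_sums[OF reduced_powers_subset reduced_powers_subset]
    by (simp add: numeral_2_eq_2)
qed

lemma min_power_sum_length_classification:
  assumes large: "e \<le> 3 * min_power_sum_length q e"
  shows "min_power_sum_length q e dvd q - 1 \<or> (e, q mod e) \<in> exceptional_residues"
proof -
  let ?m = "min_power_sum_length q e"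
  have d_e: "d dvd e" by (simp add: d_def)
  have d_m: "d dvd ?m" by (rule dvd_min_power_sum_length[OF e d_e q_cong])
  have m_pos: "0 < ?m" using large e by linarith
  show ?thesis
  proof (cases "k \<le> 3")
    case True
    have two: "?m \<le> t" if "2 \<le> t" "d dvd t" "0 < t" for t
      by (rule min_le_if_power_sums[OF twofold_power_sums[OF True] that])
    show ?thesis
    proof (cases "d \<ge> 2")
      case True
      then have "?m \<le> d" using two d_pos by simp
      then have "?m = d" using d_m m_pos by (meson dvd_imp_le le_antisym)
      then show ?thesis using d_dvd by simp
    next
      case False
      then have d1: "d = 1" using d_pos by linarith
      consider "e = 1" | "e = 2" | "e = 3" using True e e_eq d1 by fastforce
      then show ?thesis
      proof cases
        case 1
        then have "?m \<le> 1" using min_power_sum_length_le[of "[0]" e q] by simp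
        then have "?m = 1" using m_pos by linarith
        then show ?thesis by simp
      next
        case 2
        then have "odd q" using coprime by simp
        then have "gcd (q - 1) e = 2" using 2 q by (simp add: gcd_nat.absorb2)
        then show ?thesis using d1 d_def by simp
      next
        case 3
        have "q mod 3 \<noteq> 0" using coprime 3 by (auto simp: dvd_eq_mod_eq_0[symmetric])
        moreover have "q mod 3 \<noteq> 1"
        proof
          assume "q mod 3 = 1"
          then have "3 dvd q - 1" using q by presburger
          then have "gcd (q - 1) e = 3" using 3 by (simp add: gcd_nat.absorb2)
          then show False using d1 d_def by simp
        qed
        ultimately have "q mod 3 = 2" by presburger
        then show ?thesis using 3 by (simp add: exceptional_residues_def)
      qed
    qed
  next
    case False
    then have k4: "4 \<le> k" by simp
    have "d * k \<le> d * (3 * ord e q)"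
      using large min_le_mult_ord unfolding e_eq[symmetric] by linarith
    then have "k \<le> 3 * card reduced_powers"
      using d_pos ord_le_card_reduced_powers by simp
    note five = min_le_if_power_sums[OF fivefold_power_sums[OF this]]
    \<comment> \<open>Otherwise t = d is long enough, and m <= d = e/k <= e/4 contradicts m >=
      e/3.\<close>
    have "d \<le> 4"
    proof (rule ccontr)
      assume "\<not> d \<le> 4"
      then have "?m \<le> d" using five[of d] by simp
      moreover have "d * 4 \<le> d * k" using k4 by simp
      ultimately show False using large e_eq d_pos by linarith
    qed
    then consider "d = 1" | "d = 2" | "d = 3" | "d = 4" using d_pos by linarith
    \<comment> \<open>The least multiple of \<open>d\<close> that is at least 5 is 5, 6, 6, 8 for d
      = 1, 2, 3, 4; three times the largest is 24.\<close>
    then have "e \<le> 24"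
      using five[of 5] five[of 6] five[of 8] large e_eq by cases simp_all
    have e4: "4 \<le> e" using k4 e_eq d_pos by (metis le_trans mult_le_mono1 nat_mult_1 One_nat_def Suc_leI)
    \<comment> \<open>Both gcd(q - 1, e) and the divisibility of a power sum depend on
      \<open>q\<close> only modulo \<open>e\<close>, so the finite check can be indexed by
      residues.\<close>
    define g where "g = q mod e"
    have g: "1 \<le> g" "g < e" "coprime g e"
    proof -
      show "g < e" using e by (simp add: g_def)
      show "coprime g e" using coprime e by (simp add: g_def)
      then show "1 \<le> g" using e4 by (cases "g = 0") auto
    qed
    have gq: "[g ^ i = q ^ i] (mod e)" for i by (simp add: g_def cong_def power_mod)
    have "[g - 1 = q - 1] (mod e)"
      using g q cong_diff_nat[of g q e 1 1] by (simp add: g_def cong_def)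
    then have "gcd (g - 1) e = d" unfolding d_def by (rule cong_gcd_eq)
    then have "int d = gcd (int (g - 1)) (int e)" by simp
    then have "int d = gcd (int g - 1) (int e)" using g by (simp only: of_nat_diff of_nat_1)
    moreover have "int e div int d = int k" by (simp add: k_def zdiv_int)
    moreover have "coprime (int g) (int e)" using g(3) by (simp only: coprime_int_iff)
    ultimately have cond: "gcd (int g) (int e) = 1 \<and> 4 \<le> int e div gcd (int g - 1) (int e)"
      using k4 by (simp only: coprime_imp_gcd_eq_1) simp
    have e_in: "int e \<in> set [4..24]" and g_in: "int g \<in> set [1..int e - 1]"
      using e4 \<open>e \<le> 24\<close> g(1,2) by (simp_all del: upto_rec_numeral)
    note short_zero_sum_small_modulus[THEN bspec, OF e_in, THEN bspec, OF g_in, THEN mp, OF cond]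
    then show ?thesis
    proof
      assume "(int e, int g) \<in> set [(5, 2), (5, 3), (5, 4), (7, 2), (7, 4), (8, 3), (15, 4), (24, 5)]"
      then have "(e, g) \<in> exceptional_residues"
        unfolding exceptional_residues_def by (simp only: list.set insert_iff prod.inject
          of_nat_eq_numeral_iff[where 'a = int] empty_iff) blast
      then show ?thesis unfolding g_def by (rule disjI2)
    next
      assume "\<exists>(w, x, y, z) \<in> set candidate_multiplicities.
        3 * (w + x + y + z) < int e \<and>
        (w + x * int g + y * int g ^ 2 + z * int g ^ 3) mod int e = 0"
      then obtain v where v: "v \<in> set candidate_multiplicities"
        and short: "case v of (w, x, y, z) \<Rightarrow> 3 * (w + x + y + z) < int e \<and>
          (w + x * int g + y * int g ^ 2 + z * int g ^ 3) mod int e = 0" by (rule bexE)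
      obtain w' x' y' z' where v_eq: "v = (w', x', y', z')" by (cases v)
      have sum': "3 * (w' + x' + y' + z') < int e"
        "(w' + x' * int g + y' * int g ^ 2 + z' * int g ^ 3) mod int e = 0"
        using short unfolding v_eq prod.case by blast+
      have nonneg: "0 \<le> w'" "0 \<le> x'" "0 \<le> y'" "0 \<le> z'" "0 < w' + x' + y' + z'"
        using bspec[OF candidate_multiplicities_nonneg v] unfolding v_eq prod.case
        by blast+
      obtain w x y z where nats: "w' = int w" "x' = int x" "y' = int y" "z' = int z"
        using nonneg(1-4) nonneg_int_cases by metis
      have "int 0 < int (w + x + y + z)" "int (3 * (w + x + y + z)) < int e"
        using sum'(1) nonneg(5) unfolding nats by simp_all
      then have sum: "0 < w + x + y + z" "3 * (w + x + y + z) < e" by (simp_all only: of_nat_less_iff)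
      define ks where "ks = replicate w 0 @ replicate x 1 @ replicate y 2 @ replicate z (3 :: nat)"
      have "int e dvd int (w + x * g + y * g ^ 2 + z * g ^ 3)"
        using sum'(2) unfolding nats by (simp add: dvd_eq_mod_eq_0)
      then have dvd: "e dvd w + x * g + y * g ^ 2 + z * g ^ 3" by (simp only: int_dvd_int_iff)
      have "[w + x * g ^ 1 + y * g ^ 2 + z * g ^ 3 = w + x * q ^ 1 + y * q ^ 2 + z * q ^ 3] (mod e)"
        by (intro cong_add cong_mult cong_refl gq)
      then have "e dvd w + x * q + y * q ^ 2 + z * q ^ 3"
        using dvd cong_dvd_iff by (metis power_one_right)
      then have "e dvd (\<Sum>i\<leftarrow>ks. q ^ i)"
        by (simp add: ks_def sum_list_replicate add.assoc)
      then have "?m \<le> length ks" using sum(1) by (intro min_power_sum_length_le) (auto simp: ks_def)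
      then show ?thesis using sum(2) large by (simp add: ks_def)
    qed
  qed
qed

end

section \<open>Splitting the maximal exponent vector\<close>

text \<open>
  The vectors \<open>V 0, \<dots>, V (L - 1)\<close> are the exponents of \<open>L\<close> nontrivial monomials of $A(q,n,e)$ whose
  product is nonzero.
\<close>

definition splits_into :: "nat \<Rightarrow> nat \<Rightarrow> nat \<Rightarrow> nat \<Rightarrow> bool" where
  "splits_into q n e L \<longleftrightarrow> (\<exists>V :: nat \<Rightarrow> nat \<Rightarrow> nat.
    (\<forall>l<L. e dvd (\<Sum>j = 1..n. q ^ (j - 1) * V l j) \<and> (\<exists>j\<in>{1..n}. V l j \<noteq> 0)) \<and>
    (\<forall>j\<in>{1..n}. (\<Sum>l<L. V l j) \<le> q - 1))"

text \<open>Allows any finite index set in place of an initial segment; both constructions below are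
  indexed by products.\<close>

lemma splits_intoI:
  fixes W :: "'i \<Rightarrow> nat \<Rightarrow> nat"
  assumes fin: "finite T"
    and dvd: "\<And>t. t \<in> T \<Longrightarrow> e dvd (\<Sum>j = 1..n. q ^ (j - 1) * W t j)"
    and nonzero: "\<And>t. t \<in> T \<Longrightarrow> \<exists>j\<in>{1..n}. W t j \<noteq> 0"
    and total: "\<And>j. j \<in> {1..n} \<Longrightarrow> (\<Sum>t\<in>T. W t j) \<le> q - 1"
  shows "splits_into q n e (card T)"
proof -
  obtain h where h: "bij_betw h {..<card T} T"
    using ex_bij_betw_nat_finite[OF fin] by (auto simp: atLeast0LessThan)
  then have "h l \<in> T" if "l < card T" for l using that by (auto simp: bij_betw_def)
  moreover have "(\<Sum>l<card T. W (h l) j) = (\<Sum>t\<in>T. W t j)" for j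
    by (rule sum.reindex_bij_betw[OF h])
  ultimately show ?thesis
    unfolding splits_into_def using dvd nonzero total by (intro exI[of _ "\<lambda>l. W (h l)"]) simp
qed

lemma sum_shift_mod:
  fixes f :: "nat \<Rightarrow> 'a :: comm_monoid_add"
  shows "(\<Sum>r<n. f ((k + r) mod n)) = (\<Sum>s<n. f s)"
proof (cases "n = 0")
  case False
  have inj: "inj_on (\<lambda>r. (k + r) mod n) {..<n}"
  proof (rule inj_onI)
    fix r s assume "r \<in> {..<n}" "s \<in> {..<n}" "(k + r) mod n = (k + s) mod n"
    moreover from this have "[r = s] (mod n)" using cong_add_lcancel_nat[of k r s n] by (simp add: cong_def)
    ultimately show "r = s" by (simp add: cong_def)
  qed
  then have "(\<lambda>r. (k + r) mod n) ` {..<n} = {..<n}"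
    using False by (intro endo_inj_surj) auto
  then show ?thesis using sum.reindex[OF inj, of f] by (simp add: comp_def)
qed simp

text \<open>
  Since $q^n \equiv 1$ modulo $e$, divisibility is preserved by cyclic shifts of the exponents, and the
  $n$ shifts of one sum use every exponent equally often.
\<close>

lemma splits_into_rotations:
  assumes n: "n \<ge> 1" and ks: "ks \<noteq> []" "e dvd (\<Sum>k\<leftarrow>ks. q ^ k)" and q: "[q ^ n = 1] (mod e)"
    and c: "c * length ks = q - 1"
  shows "splits_into q n e (n * c)"
proof -
  \<comment> \<open>Variable j carries the exponent j - 1, hence the shift by one. Entries of
    \<open>ks\<close> may be n or more, so the shifted exponents are reduced modulo
    \<open>n\<close>.\<close>
  define W where "W r j = length (filter (\<lambda>k. (k + r) mod n + 1 = j) ks)" for r j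
  have weight: "(\<Sum>j = 1..n. q ^ (j - 1) * W r j) = (\<Sum>k\<leftarrow>ks. q ^ ((k + r) mod n))" for r
  proof -
    have "(\<Sum>j = 1..n. q ^ (j - 1) * length (filter (\<lambda>k. (k + r) mod n + 1 = j) xs))
        = (\<Sum>k\<leftarrow>xs. q ^ ((k + r) mod n))" for xs
    proof (induction xs)
      case (Cons k xs)
      have "(\<Sum>j = 1..n. q ^ (j - 1) * length (filter (\<lambda>k. (k + r) mod n + 1 = j) (k # xs)))
          = (\<Sum>j = 1..n. (if (k + r) mod n + 1 = j then q ^ (j - 1) else 0)
              + q ^ (j - 1) * length (filter (\<lambda>k. (k + r) mod n + 1 = j) xs))"
        by (intro sum.cong refl) simp
      also have "\<dots> = q ^ ((k + r) mod n) + (\<Sum>k\<leftarrow>xs. q ^ ((k + r) mod n))"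
        using n by (subst sum.distrib, subst Cons.IH) (simp add: Suc_le_eq)
      finally show ?case by simp
    qed simp
    then show ?thesis by (simp add: W_def)
  qed
  have rot: "(\<Sum>r<n. W r j) = length ks" if j: "j \<in> {1..n}" for j
  proof -
    have "(\<Sum>r<n. length (filter (\<lambda>k. (k + r) mod n + 1 = j) xs)) = length xs" for xs
    proof (induction xs)
      case (Cons k xs)
      have "(\<Sum>r<n. length (filter (\<lambda>k. (k + r) mod n + 1 = j) (k # xs)))
          = (\<Sum>r<n. (if (k + r) mod n + 1 = j then 1 else 0)
              + length (filter (\<lambda>k. (k + r) mod n + 1 = j) xs))"
        by (intro sum.cong refl) simp
      also have "\<dots> = (\<Sum>s<n. if s + 1 = j then 1 else 0) + length xs"
        by (subst sum.distrib, subst Cons.IH, subst sum_shift_mod[of "\<lambda>s. if s + 1 = j then 1 else 0"])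
          (rule refl)
      also have "(\<Sum>s<n. if s + 1 = j then 1 else 0) = (\<Sum>s<n. if s = j - 1 then 1 else (0 :: nat))"
        using j by (intro sum.cong refl) auto
      also have "\<dots> = 1" using j by (subst sum.delta) auto
      finally show ?case by simp
    qed simp
    then show ?thesis by (simp add: W_def)
  qed
  \<comment> \<open>The second index merely repeats each of the \<open>n\<close> shifts
    \<open>c\<close> times, so every variable is used \<open>c * length ks = q - 1\<close>
    times.\<close>
  have "splits_into q n e (card ({..<n} \<times> {..<c}))"
  proof (rule splits_intoI[where W = "\<lambda>(r, u). W r"])
    show "e dvd (\<Sum>j = 1..n. q ^ (j - 1) * (case t of (r, u) \<Rightarrow> W r) j)" if "t \<in> {..<n} \<times> {..<c}" for t
    proof -
      obtain r u where t: "t = (r, u)" by (cases t)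
      have "[(\<Sum>k\<leftarrow>xs. q ^ ((k + r) mod n)) = q ^ r * (\<Sum>k\<leftarrow>xs. q ^ k)] (mod e)" for xs
      proof (induction xs)
        case (Cons k xs)
        have "[(q ^ n) ^ ((k + r) div n) * q ^ ((k + r) mod n) = 1 ^ ((k + r) div n) * q ^ ((k + r) mod n)] (mod e)"
          by (intro cong_mult cong_pow q cong_refl)
        then have "[q ^ (k + r) = q ^ ((k + r) mod n)] (mod e)"
          by (simp add: power_mult[symmetric] power_add[symmetric])
        then have "[q ^ ((k + r) mod n) + (\<Sum>k\<leftarrow>xs. q ^ ((k + r) mod n))
            = q ^ (k + r) + q ^ r * (\<Sum>k\<leftarrow>xs. q ^ k)] (mod e)"
          by (intro cong_add Cons.IH) (rule cong_sym)
        then show ?case by (simp add: power_add algebra_simps)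
      qed simp
      from this[of ks] show ?thesis using ks weight[of r] by (simp add: t cong_dvd_iff)
    qed
    show "\<exists>j\<in>{1..n}. (case t of (r, u) \<Rightarrow> W r) j \<noteq> 0" if "t \<in> {..<n} \<times> {..<c}" for t
    proof -
      obtain r u where t: "t = (r, u)" by (cases t)
      have "hd ks \<in> set (filter (\<lambda>k. (k + r) mod n + 1 = (hd ks + r) mod n + 1) ks)"
        using ks by simp
      then have "W r ((hd ks + r) mod n + 1) \<noteq> 0" unfolding W_def by (metis length_0_conv list.set(1) empty_iff)
      moreover have "(hd ks + r) mod n + 1 \<in> {1..n}" using n by (simp add: Suc_le_eq)
      ultimately show ?thesis unfolding t prod.case by (rule bexI)
    qed
    show "(\<Sum>t\<in>{..<n} \<times> {..<c}. (case t of (r, u) \<Rightarrow> W r) j) \<le> q - 1" if "j \<in> {1..n}" for j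
    proof -
      have "(\<Sum>t\<in>{..<n} \<times> {..<c}. (case t of (r, u) \<Rightarrow> W r) j) = (\<Sum>r<n. \<Sum>u<c. W r j)"
        by (simp only: sum.cartesian_product split_def fst_conv snd_conv)
      also have "\<dots> = c * (\<Sum>r<n. W r j)" by (simp add: sum_distrib_left)
      finally show ?thesis using rot[OF that] c by simp
    qed
  qed simp
  then show ?thesis by simp
qed

text \<open>
  Here the exponents $0, \dots, n - 1$ are tiled by translates of the progression
  $0, j, \dots, (r-1)j$, each used with multiplicity $c$.
\<close>

lemma splits_into_blocks:
  assumes pos: "0 < c" "0 < r" "0 < j" and n: "j * r dvd n"
    and dvd: "e dvd c * (\<Sum>i<r. q ^ (i * j))" and u: "c * u = q - 1"
  shows "splits_into q n e ((n div (j * r)) * j * u)"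
proof -
  define p where "p = j * r"
  \<comment> \<open>The exponents are cut into blocks of length \<open>p\<close>, and each block
    into its residue classes modulo \<open>j\<close>. Since \<open>j\<close> divides
    \<open>p\<close>, such a class is a progression of \<open>r\<close> terms with difference
    \<open>j\<close>.\<close>
  define S where "S s t = {y. y div p = s \<and> y mod j = t}" for s t
  define W where "W s t x = (if x - 1 \<in> S s t then c else 0)" for s t x
  have p: "0 < p" using pos by (simp add: p_def)
  have block: "S s t = (\<lambda>i. p * s + i * j + t) ` {..<r}" if "t < j" for s t
  proof (intro equalityI subsetI)
    fix y assume "y \<in> S s t"
    then have y: "y div p = s" "y mod j = t" by (auto simp: S_def)
    have "y mod p mod j = t" using y by (simp add: p_def mod_mod_cancel)
    moreover have "y = p * (y div p) + ((y mod p) div j * j + (y mod p) mod j)" by simp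
    ultimately have "y = p * s + (y mod p) div j * j + t" using y(1) by simp
    moreover have "(y mod p) div j < r"
      using p pos by (simp add: p_def less_mult_imp_div_less mult.commute)
    ultimately show "y \<in> (\<lambda>i. p * s + i * j + t) ` {..<r}" by (rule image_eqI[OF _ lessThan_iff[THEN iffD2]])
  next
    fix y assume "y \<in> (\<lambda>i. p * s + i * j + t) ` {..<r}"
    then obtain i where i: "i < r" "y = p * s + (i * j + t)" by auto
    have "i * j + t < Suc i * j" using that by simp
    also have "\<dots> \<le> p" unfolding p_def using i by (metis Suc_leI mult_le_mono1 mult.commute)
    finally have "i * j + t < p" .
    then have "y div p = s" using i p by simp
    moreover have "y mod j = t" using i that by (simp add: p_def mult.assoc)
    ultimately show "y \<in> S s t" by (simp add: S_def)
  qed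
  have lt: "y < n" if "y \<in> S s t" "s < n div p" for y s t
  proof -
    have "y div p < n div p" using that by (auto simp: S_def)
    then show ?thesis by (metis div_le_mono not_less)
  qed
  let ?T = "{..<n div p} \<times> {..<j} \<times> {..<u}"
  \<comment> \<open>Every exponent lies in exactly one \<open>S s t\<close>. The third index repeats
    each tile \<open>u\<close> times, which uses up \<open>c * u = q - 1\<close>.\<close>
  have "splits_into q n e (card ?T)"
  proof (rule splits_intoI[where W = "\<lambda>(s, t, _). W s t"])
    fix x assume "x \<in> ?T"
    then obtain s t v where x: "x = (s, t, v)" "s < n div p" "t < j" by auto
    have inj: "inj_on (\<lambda>i. p * s + i * j + t) {..<r}" using pos by (auto intro!: inj_onI)
    have "(\<Sum>x = 1..n. q ^ (x - 1) * W s t x) = (\<Sum>y<n. q ^ y * W s t (Suc y))"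
      by (rule sum.reindex_bij_witness[of _ Suc "\<lambda>x. x - 1"]) auto
    also have "\<dots> = (\<Sum>y\<in>S s t. q ^ y * c)"
      using lt[OF _ x(2)] by (intro sum.mono_neutral_cong_right) (auto simp: W_def)
    also have "\<dots> = (\<Sum>i<r. q ^ (p * s + i * j + t) * c)"
      unfolding block[OF x(3)] by (subst sum.reindex[OF inj]) simp
    also have "\<dots> = q ^ (p * s + t) * (c * (\<Sum>i<r. q ^ (i * j)))"
      by (simp add: sum_distrib_left power_add algebra_simps)
    finally show "e dvd (\<Sum>xa = 1..n. q ^ (xa - 1) * (case x of (s, t, _) \<Rightarrow> W s t) xa)"
      using dvd by (simp add: x)
    have y: "p * s + 0 * j + t \<in> S s t" unfolding block[OF x(3)] using pos by blast
    then have "W s t (Suc (p * s + t)) \<noteq> 0" using pos by (simp add: W_def)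
    moreover have "Suc (p * s + t) \<in> {1..n}" using lt[OF y x(2)] by simp
    ultimately show "\<exists>xa\<in>{1..n}. (case x of (s, t, _) \<Rightarrow> W s t) xa \<noteq> 0"
      unfolding x prod.case by (rule bexI)
  next
    fix x assume "x \<in> {1..n}"
    have "(\<Sum>z\<in>?T. (case z of (s, t, _) \<Rightarrow> W s t) x)
        = (\<Sum>s<n div p. \<Sum>t<j. \<Sum>v<u. W s t x)"
      by (simp only: sum.cartesian_product split_def fst_conv snd_conv)
    also have "\<dots> = (\<Sum>s<n div p. \<Sum>t<j. if s = (x - 1) div p \<and> t = (x - 1) mod j then u * c else 0)"
      by (intro sum.cong refl) (auto simp: W_def S_def)
    also have "\<dots> = (\<Sum>s<n div p. if s = (x - 1) div p then u * c else 0)"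
      using pos by (intro sum.cong refl) (auto simp: sum.delta)
    also have "\<dots> \<le> u * c" by (simp add: sum.delta)
    finally show "(\<Sum>z\<in>?T. (case z of (s, t, _) \<Rightarrow> W s t) x) \<le> q - 1"
      using u by (simp add: mult.commute)
  qed simp
  then show ?thesis by (simp add: p_def mult.assoc)
qed

text \<open>In each case c = gcd(g - 1, e). The difference \<open>j\<close> is 1 except for e = 5
  and g = 2, 3, where g^2 = -1 makes 1 + g^2 vanish modulo 5. The last clause pins m down from its
  bounds and its divisor \<open>c\<close>; the bound m >= 2 decides e = 3.\<close>

lemma exceptional_blocks:
  assumes "(e, g) \<in> exceptional_residues"
  obtains c r j where "0 < c" "0 < r" "0 < j" "c dvd e" "[g = 1] (mod c)"
    "e dvd c * (\<Sum>i<r. g ^ (i * j))" "ord e g = j * r"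
    "\<And>m. e \<le> 3 * m \<Longrightarrow> 2 \<le> m \<Longrightarrow> c dvd m \<Longrightarrow> m \<le> c * r \<Longrightarrow> m = c * r"
proof -
  have ords: "ord 3 (2 :: nat) = 2" "ord 5 (4 :: nat) = 2" "ord 5 (2 :: nat) = 4" "ord 5 (3 :: nat) = 4"
    "ord 7 (2 :: nat) = 3" "ord 7 (4 :: nat) = 3" "ord 8 (3 :: nat) = 2" "ord 15 (4 :: nat) = 2"
    "ord 24 (5 :: nat) = 2"
    by code_simp+
  have sets: "{..<2 :: nat} = {0, 1}" "{..<3 :: nat} = {0, 1, 2}" by auto
  consider "(e, g) \<in> {(3, 2), (5, 4)}" | "(e, g) \<in> {(5, 2), (5, 3)}" | "(e, g) \<in> {(7, 2), (7, 4)}"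
    | "(e, g) = (8, 3)" | "(e, g) = (15, 4)" | "(e, g) = (24, 5)"
    using assms unfolding exceptional_residues_def by blast
  then show thesis
  proof cases
    case 1
    then show ?thesis by (intro that[of 1 2 1]) (auto simp: ords sets)
  next
    case 2
    then show ?thesis by (intro that[of 1 2 2]) (auto simp: ords sets)
  next
    case 3
    then show ?thesis by (intro that[of 1 3 1]) (auto simp: ords sets)
  next
    case 4
    then show ?thesis by (intro that[of 2 2 1]) (auto simp: ords sets cong_def elim!: dvdE)
  next
    case 5
    then show ?thesis by (intro that[of 3 2 1]) (auto simp: ords sets cong_def elim!: dvdE)
  next
    case 6
    then show ?thesis by (intro that[of 4 2 1]) (auto simp: ords sets cong_def)
  qed
qed

context coprime_base
begin

lemma splits_into_if_large:
  assumes large: "e \<le> 3 * min_power_sum_length q e" and n: "n \<ge> 1" and q_n: "[q ^ n = 1] (mod e)"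
  obtains L where "min_power_sum_length q e * L = n * (q - 1)" "splits_into q n e L"
proof -
  let ?m = "min_power_sum_length q e"
  obtain ks where ks: "ks \<noteq> []" "length ks = ?m" "e dvd (\<Sum>k\<leftarrow>ks. q ^ k)"
    by (rule min_power_sum_length_witness[OF e])
  consider "?m dvd q - 1" | "(e, q mod e) \<in> exceptional_residues"
    using min_power_sum_length_classification[OF large] by blast
  then show thesis
  proof cases
    case 1
    then obtain c where c: "q - 1 = ?m * c" by (rule dvdE)
    have "splits_into q n e (n * c)"
      using c ks(2) by (intro splits_into_rotations[OF n ks(1,3) q_n]) simp
    then show thesis using that[of "n * c"] c by simp
  next
    case 2
    obtain c r j where crj: "0 < c" "0 < r" "0 < j" "c dvd e" "[q mod e = 1] (mod c)"
      "e dvd c * (\<Sum>i<r. (q mod e) ^ (i * j))" "ord e (q mod e) = j * r"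
      and m_eq: "\<And>m. e \<le> 3 * m \<Longrightarrow> 2 \<le> m \<Longrightarrow> c dvd m \<Longrightarrow> m \<le> c * r \<Longrightarrow> m = c * r"
      using exceptional_blocks[OF 2] by blast
    have "[q mod e = q] (mod c)" using crj(4) by (simp add: cong_def mod_mod_cancel)
    then have q_c: "[q = 1] (mod c)" using crj(5) cong_sym cong_trans by blast
    have "[c * (\<Sum>i<r. (q mod e) ^ (i * j)) = c * (\<Sum>i<r. q ^ (i * j))] (mod e)"
      by (intro cong_mult cong_sum cong_pow cong_refl) (simp add: cong_def)
    then have dvd: "e dvd c * (\<Sum>i<r. q ^ (i * j))" using crj(6) cong_dvd_iff by blast
    \<comment> \<open>The order of \<open>q\<close> modulo \<open>e\<close> divides
      \<open>n\<close>, so whole blocks tile the exponents.\<close>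
    have jr: "j * r dvd n" using crj(7) q_n ord_divides[of q n e] by simp
    define as where "as = concat (replicate c (map (\<lambda>i. i * j) [0..<r]))"
    have "(\<Sum>k\<leftarrow>as. q ^ k) = c * (\<Sum>i<r. q ^ (i * j))"
      unfolding as_def
      by (induction c) (simp_all add: comp_def sum_list_distinct_conv_sum_set atLeast0LessThan)
    moreover have len: "length as = c * r" unfolding as_def by (induction c) simp_all
    moreover have "as \<noteq> []" using len crj(1,2) by (metis length_0_conv mult_pos_pos less_numeral_extra(3))
    ultimately have "?m \<le> c * r" using dvd min_power_sum_length_le[of as e q] by simp
    \<comment> \<open>A single power of \<open>q\<close> is coprime to \<open>e\<close>, and
      \<open>e\<close> exceeds 1 in every exceptional case.\<close>
    moreover have "2 \<le> ?m"
    proof (rule ccontr)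
      assume "\<not> 2 \<le> ?m"
      then have "length ks = 1" using ks(1,2) by (cases ks) auto
      then obtain k where "ks = [k]" by (auto simp: length_Suc_conv)
      then have "e dvd q ^ k" using ks(3) by simp
      moreover have "coprime (q ^ k) e" using coprime by simp
      ultimately have "e dvd 1" using coprime_common_divisor[of "q ^ k" e e] by simp
      then show False using 2 by (auto simp: exceptional_residues_def)
    qed
    moreover have "c dvd ?m" by (rule dvd_min_power_sum_length[OF e crj(4) q_c])
    ultimately have m: "?m = c * r" using m_eq large by blast
    obtain u where u: "q - 1 = c * u" using q_c q by (metis cong_altdef_nat dvdE less_imp_le)
    obtain N where N: "n = j * r * N" using jr by (rule dvdE)
    have "splits_into q n e ((n div (j * r)) * j * u)"
      by (rule splits_into_blocks[OF crj(1-3) jr dvd u[symmetric]])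
    moreover have "?m * ((n div (j * r)) * j * u) = n * (q - 1)"
      unfolding m u N using crj(1-3) by simp
    ultimately show thesis using that by blast
  qed
qed

end

section \<open>The truncated polynomial ring\<close>

locale truncated_polynomials =
  fixes q n e :: nat and field_type :: "'f::field itself"
  assumes q_gt_1: "q > 1" and n_ge_1: "n \<ge> 1" and e_ge_1: "e \<ge> 1"
begin

abbreviation P :: "'f mpoly ring" where "P \<equiv> mpoly_ring n"
abbreviation I :: "'f mpoly set" where "I \<equiv> trunc_ideal q n"
abbreviation Q :: "'f mpoly set ring" where "Q \<equiv> trunc_ring q n"
abbreviation B :: "'f mpoly set ring" where "B \<equiv> monomial_algebra q n e"
abbreviation scalars :: "'f mpoly set set" where "scalars \<equiv> trunc_scalars q n"
abbreviation proj :: "'f mpoly \<Rightarrow> 'f mpoly set" where "proj p \<equiv> I +>\<^bsub>P\<^esub> p"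

text \<open>\<open>I\<close> is spanned by the monomials whose exponent vector is \<open>high\<close>.\<close>

definition high :: "(nat \<Rightarrow>\<^sub>0 nat) \<Rightarrow> bool" where
  "high v \<longleftrightarrow> (\<exists>j. q \<le> Poly_Mapping.lookup v j)"

definition deg :: "(nat \<Rightarrow>\<^sub>0 nat) \<Rightarrow> nat" where
  "deg v = (\<Sum>j = 1..n. Poly_Mapping.lookup v j)"

definition wt :: "(nat \<Rightarrow>\<^sub>0 nat) \<Rightarrow> nat" where
  "wt v = (\<Sum>j = 1..n. q ^ (j - 1) * Poly_Mapping.lookup v j)"

text \<open>One notion of monomial span serves for \<open>I\<close>, \<open>zero_sum_polys\<close>
  and \<open>degree_ge\<close>; closure under products then reduces to a condition on sums of
  exponent vectors.\<close>

definition supported :: "((nat \<Rightarrow>\<^sub>0 nat) \<Rightarrow> bool) \<Rightarrow> 'f mpoly set" where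
  "supported \<Phi> = {p \<in> carrier P. \<forall>v \<in> Poly_Mapping.keys p. \<Phi> v}"

definition vec :: "(nat \<Rightarrow> nat) \<Rightarrow> (nat \<Rightarrow>\<^sub>0 nat)" where
  "vec a = (\<Sum>j = 1..n. Poly_Mapping.single j (a j))"

abbreviation mono :: "(nat \<Rightarrow>\<^sub>0 nat) \<Rightarrow> 'f mpoly" where
  "mono v \<equiv> Poly_Mapping.single v 1"

lemma P_simps: "x \<otimes>\<^bsub>P\<^esub> y = x * y" "\<one>\<^bsub>P\<^esub> = 1" "x \<oplus>\<^bsub>P\<^esub> y = x + y" "\<zero>\<^bsub>P\<^esub> = 0"
  by (simp_all add: mpoly_ring_def)

lemma in_carrier_P: "p \<in> carrier P \<longleftrightarrow> (\<forall>v \<in> Poly_Mapping.keys p. Poly_Mapping.keys v \<subseteq> {1..n})"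
  by (simp add: mpoly_ring_def)

sublocale P: cring P by (rule cring_mpoly_ring)
sublocale Q: cring Q by (rule cring_trunc_ring)
sublocale B: cring B by (rule cring_monomial_algebra)
sublocale I: ideal I P by (rule ideal_trunc_ideal)

sublocale proj: ring_hom_cring P Q proj
  unfolding trunc_ring_def by (rule I.rcos_ring_hom_cring[OF cring_mpoly_ring])

lemma P_uminus: "p \<in> carrier P \<Longrightarrow> \<ominus>\<^bsub>P\<^esub> p = - p"
  by (rule P.minus_equality) (auto simp: P_simps in_carrier_P)

lemma lookup_vec: "Poly_Mapping.lookup (vec a) j = (if j \<in> {1..n} then a j else 0)"
  unfolding vec_def lookup_sum lookup_single by (auto simp: when_def)

lemma keys_vec: "Poly_Mapping.keys (vec a) \<subseteq> {1..n}"
  by (auto simp: in_keys_iff lookup_vec split: if_splits)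

lemma mono_vec_in_carrier: "mono (vec a) \<in> carrier P"
  using keys_vec by (simp add: in_carrier_P)

lemma vec_add: "vec (\<lambda>j. a j + b j) = vec a + vec b"
  unfolding vec_def by (simp add: single_add sum.distrib)

lemma vec_0: "vec (\<lambda>_. 0) = 0"
  by (simp add: vec_def)

lemma mono_add: "mono (v + w) = mono v * mono w"
  by (simp add: mult_single)

lemma high_add: "high v \<Longrightarrow> high (v + w)" "high w \<Longrightarrow> high (v + w)"
  unfolding high_def by (auto simp: lookup_add intro: trans_le_add1 trans_le_add2)

lemma not_high_0: "\<not> high 0"
  using q_gt_1 by (simp add: high_def)

lemma deg_add: "deg (v + w) = deg v + deg w"
  by (simp add: deg_def lookup_add sum.distrib)

lemma wt_add: "wt (v + w) = wt v + wt w"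
  by (simp add: wt_def lookup_add sum.distrib algebra_simps)

lemma wt_vec: "wt (vec a) = (\<Sum>j = 1..n. q ^ (j - 1) * a j)"
  by (simp add: wt_def lookup_vec)

lemma supported_carrier: "p \<in> supported \<Phi> \<Longrightarrow> p \<in> carrier P"
  by (simp add: supported_def)

lemma zero_in_supported: "0 \<in> supported \<Phi>"
  by (simp add: supported_def in_carrier_P)

lemma supported_add: "p \<in> supported \<Phi> \<Longrightarrow> r \<in> supported \<Phi> \<Longrightarrow> p + r \<in> supported \<Phi>"
  using Poly_Mapping.keys_add[of p r] unfolding supported_def in_carrier_P by blast

lemma supported_uminus: "p \<in> supported \<Phi> \<Longrightarrow> - p \<in> supported \<Phi>"
  by (simp add: supported_def in_carrier_P)

lemma supported_mult:
  assumes "p \<in> supported \<Phi>" "r \<in> supported \<Psi>" "\<And>v w. \<Phi> v \<Longrightarrow> \<Psi> w \<Longrightarrow> \<Theta> (v + w)"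
  shows "p * r \<in> supported \<Theta>"
proof -
  have "p * r \<in> carrier P"
    using P.m_closed[of p r] assms(1,2) by (simp add: supported_def P_simps)
  moreover have "\<Theta> v" if "v \<in> Poly_Mapping.keys (p * r)" for v
    using that keys_mult[of p r] assms unfolding supported_def by blast
  ultimately show ?thesis by (simp add: supported_def)
qed

lemma supported_mono: "(\<And>v. \<Phi> v \<Longrightarrow> \<Psi> v) \<Longrightarrow> supported \<Phi> \<subseteq> supported \<Psi>"
  by (auto simp: supported_def)

lemma carrier_eq_supported: "carrier P = supported (\<lambda>_. True)"
  by (auto simp: supported_def)

lemma supported_subgroup: "subgroup (supported \<Phi>) (add_monoid P)"
proof (rule P.add.subgroupI)
  show "supported \<Phi> \<noteq> {}" using zero_in_supported by blast
qed (auto simp: P_simps P_uminus supported_carrier supported_add supported_uminus)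

lemma supported_ideal:
  assumes "\<And>v w. \<Phi> v \<Longrightarrow> \<Phi> (v + w)"
  shows "ideal (supported \<Phi>) P"
proof (rule idealI)
  show "subgroup (supported \<Phi>) (add_monoid P)" by (rule supported_subgroup)
  fix p r assume p: "p \<in> supported \<Phi>" and r: "r \<in> carrier P"
  have "p * r \<in> supported \<Phi>"
    using p r assms unfolding carrier_eq_supported by (rule supported_mult)
  then show "p \<otimes>\<^bsub>P\<^esub> r \<in> supported \<Phi>" "r \<otimes>\<^bsub>P\<^esub> p \<in> supported \<Phi>"
    by (simp_all add: P_simps mult.commute)
qed (rule P.ring_axioms)

lemma var_power: "mpoly_var j [^]\<^bsub>P\<^esub> (k :: nat) = mono (Poly_Mapping.single j k)"
  by (induction k) (simp_all add: P_simps mpoly_var_def mult_single single_add[symmetric])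

lemma poly_eq_sum_single:
  fixes p :: "'f mpoly"
  shows "p = (\<Sum>v\<in>Poly_Mapping.keys p. Poly_Mapping.single v (Poly_Mapping.lookup p v))"
proof (rule poly_mapping_eqI)
  fix w
  have "Poly_Mapping.lookup (\<Sum>v\<in>Poly_Mapping.keys p. Poly_Mapping.single v (Poly_Mapping.lookup p v)) w
      = (\<Sum>v\<in>Poly_Mapping.keys p. if v = w then Poly_Mapping.lookup p v else 0)"
    unfolding lookup_sum lookup_single by (intro sum.cong refl) (simp add: when_def)
  also have "\<dots> = Poly_Mapping.lookup p w" by (simp add: sum.delta' in_keys_iff)
  finally show "Poly_Mapping.lookup p w = Poly_Mapping.lookup
    (\<Sum>v\<in>Poly_Mapping.keys p. Poly_Mapping.single v (Poly_Mapping.lookup p v)) w" by simp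
qed

text \<open>The ideal is generated by monomials, so membership is tested monomial by monomial, and
  the vanishing of a coset becomes a question about exponents.\<close>

lemma trunc_ideal_eq: "I = supported high"
proof
  show "I \<subseteq> supported high" unfolding trunc_ideal_def
  proof (rule P.genideal_minimal)
    show "ideal (supported high) P" by (rule supported_ideal) (rule high_add)
    show "(\<lambda>j. mpoly_var j [^]\<^bsub>P\<^esub> q) ` {1..n} \<subseteq> supported high"
    proof (intro image_subsetI)
      fix j assume j: "j \<in> {1..n}"
      have "high (Poly_Mapping.single j q)" unfolding high_def by (rule exI[of _ j]) simp
      then show "mpoly_var j [^]\<^bsub>P\<^esub> q \<in> supported high"
        using j by (simp add: var_power supported_def in_carrier_P)
    qed
  qed
  show "supported high \<subseteq> I"
  proof
    fix p assume p: "p \<in> supported high"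
    have "Poly_Mapping.single v c \<in> I" if v: "v \<in> Poly_Mapping.keys p" for v c
    proof -
      have v_n: "Poly_Mapping.keys v \<subseteq> {1..n}" and "high v"
        using p v by (auto simp: supported_def in_carrier_P)
      then obtain j where j: "q \<le> Poly_Mapping.lookup v j" by (auto simp: high_def)
      then have "j \<in> {1..n}" using v_n q_gt_1 by (metis in_keys_iff le_zero_eq not_one_less_zero subsetD)
      then have "mpoly_var j [^]\<^bsub>P\<^esub> q \<in> I" unfolding trunc_ideal_def
        by (intro P.genideal_self[THEN subsetD]) (auto intro!: P.nat_pow_closed mpoly_var_in_carrier)
      then have gen: "mono (Poly_Mapping.single j q) \<in> I" by (simp add: var_power)
      \<comment> \<open>The subtraction is exact because entry \<open>j\<close> is at least
        \<open>q\<close>; so the term is a multiple of the q-th power of variable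
        \<open>j\<close>.\<close>
      define w where "w = v - Poly_Mapping.single j q"
      have "v = Poly_Mapping.single j q + w"
        using j by (intro poly_mapping_eqI) (auto simp: w_def lookup_add lookup_minus lookup_single when_def)
      then have "Poly_Mapping.single v c = mono (Poly_Mapping.single j q) \<otimes>\<^bsub>P\<^esub> Poly_Mapping.single w c"
        by (simp add: P_simps mult_single)
      moreover have "Poly_Mapping.keys w \<subseteq> Poly_Mapping.keys v"
        by (auto simp: w_def in_keys_iff lookup_minus)
      then have "Poly_Mapping.single w c \<in> carrier P" using v_n by (auto simp: in_carrier_P)
      ultimately show ?thesis using I.I_r_closed[OF gen] by simp
    qed
    moreover have "(\<Sum>v\<in>K. Poly_Mapping.single v (Poly_Mapping.lookup p v)) \<in> I"
      if "finite K" "\<And>v c. v \<in> K \<Longrightarrow> Poly_Mapping.single v c \<in> I" for K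
      using that
    proof (induction K)
      case empty
      then show ?case using I.zero_closed by (simp add: P_simps)
    next
      case (insert v K)
      then show ?case using I.a_closed[of "Poly_Mapping.single v (Poly_Mapping.lookup p v)"
          "\<Sum>v\<in>K. Poly_Mapping.single v (Poly_Mapping.lookup p v)"] by (simp add: P_simps)
    qed
    ultimately show "p \<in> I" by (subst poly_eq_sum_single) simp
  qed
qed

lemma proj_eq_zero_iff:
  assumes "p \<in> carrier P"
  shows "proj p = \<zero>\<^bsub>Q\<^esub> \<longleftrightarrow> p \<in> I"
proof -
  have zero: "\<zero>\<^bsub>Q\<^esub> = I" unfolding trunc_ring_def FactRing_def by simp
  show ?thesis unfolding zero
  proof
    assume "proj p = I"
    then show "p \<in> I" by (rule I.rcos_const_imp_mem[OF assms])
  next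
    assume "p \<in> I"
    then show "proj p = I" by (rule P.a_rcos_zero[OF ideal_trunc_ideal])
  qed
qed

lemma proj_nat_pow: "p \<in> carrier P \<Longrightarrow> proj (p [^]\<^bsub>P\<^esub> (k :: nat)) = proj p [^]\<^bsub>Q\<^esub> k"
  by (induction k) (simp_all add: proj.hom_mult)

lemma trunc_monom_eq: "trunc_monom q n a = proj (mono (vec a))"
proof -
  have closed: "(\<lambda>j. mpoly_var j [^]\<^bsub>P\<^esub> a j) \<in> {1..n} \<rightarrow> carrier P"
    by (intro Pi_I P.nat_pow_closed mpoly_var_in_carrier)
  have "trunc_monom q n a = (\<Otimes>\<^bsub>Q\<^esub> j \<in> {1..n}. (proj \<circ> (\<lambda>j. mpoly_var j [^]\<^bsub>P\<^esub> a j)) j)"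
    unfolding trunc_monom_def trunc_var_def
  proof (rule Q.finprod_cong'[OF refl])
    show "proj \<circ> (\<lambda>j. mpoly_var j [^]\<^bsub>P\<^esub> a j) \<in> {1..n} \<rightarrow> carrier Q"
      by (intro Pi_I) (simp only: comp_apply proj.hom_closed P.nat_pow_closed mpoly_var_in_carrier)
    show "proj (mpoly_var j) [^]\<^bsub>Q\<^esub> a j = (proj \<circ> (\<lambda>j. mpoly_var j [^]\<^bsub>P\<^esub> a j)) j" if "j \<in> {1..n}" for j
      using proj_nat_pow[OF mpoly_var_in_carrier[OF that]] by simp
  qed
  also have "\<dots> = proj (\<Otimes>\<^bsub>P\<^esub> j \<in> {1..n}. mpoly_var j [^]\<^bsub>P\<^esub> a j)"
    using proj.hom_finprod[OF closed] by simp
  also have "(\<Otimes>\<^bsub>P\<^esub> j \<in> {1..n}. mpoly_var j [^]\<^bsub>P\<^esub> a j) = mono (vec a)"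
  proof -
    have "(\<Otimes>\<^bsub>P\<^esub> j \<in> J. mpoly_var j [^]\<^bsub>P\<^esub> a j) = mono (\<Sum>j\<in>J. Poly_Mapping.single j (a j))"
      if "finite J" "J \<subseteq> {1..n}" for J
      using that
    proof (induction J)
      case empty
      then show ?case by (simp add: P_simps)
    next
      case (insert j J)
      have "(\<lambda>j. mpoly_var j [^]\<^bsub>P\<^esub> a j) \<in> J \<rightarrow> carrier P" "mpoly_var j [^]\<^bsub>P\<^esub> a j \<in> carrier P"
        using insert.prems by (intro Pi_I P.nat_pow_closed mpoly_var_in_carrier; blast)+
      then have "(\<Otimes>\<^bsub>P\<^esub> j \<in> insert j J. mpoly_var j [^]\<^bsub>P\<^esub> a j)
          = mono (Poly_Mapping.single j (a j)) * mono (\<Sum>j\<in>J. Poly_Mapping.single j (a j))"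
        using insert by (simp only: P.finprod_insert insert_subset P_simps var_power simp_thms)
      then show ?case using insert.hyps by (simp add: mult_single)
    qed
    then show ?thesis by (simp add: vec_def)
  qed
  finally show ?thesis .
qed

section \<open>Representatives of the elements of the monomial algebra\<close>

definition zero_sum_polys :: "'f mpoly set" where
  "zero_sum_polys = supported (\<lambda>v. high v \<or> e dvd wt v)"

lemma B_simps: "x \<otimes>\<^bsub>B\<^esub> y = x \<otimes>\<^bsub>Q\<^esub> y" "\<one>\<^bsub>B\<^esub> = \<one>\<^bsub>Q\<^esub>" "x \<oplus>\<^bsub>B\<^esub> y = x \<oplus>\<^bsub>Q\<^esub> y" "\<zero>\<^bsub>B\<^esub> = \<zero>\<^bsub>Q\<^esub>"
  by (simp_all add: monomial_algebra_def)

lemma carrier_B: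
  "carrier B = \<Inter>{S. subring S Q \<and> subalgebra scalars S Q \<and>
    (\<lambda>a. proj (mono (vec a))) ` {a. e dvd wt (vec a)} \<subseteq> S}"
proof -
  have "trunc_monom q n ` {a. [(\<Sum>j = 1..n. q ^ (j - 1) * a j) = 0] (mod e)}
      = (\<lambda>a. proj (mono (vec a))) ` {a. e dvd wt (vec a)}"
    by (intro image_cong) (simp_all only: trunc_monom_eq cong_0_iff wt_vec)
  moreover have "carrier B = generated_subalgebra scalars Q
      (trunc_monom q n ` {a. [(\<Sum>j = 1..n. q ^ (j - 1) * a j) = 0] (mod e)})"
    by (simp add: monomial_algebra_def)
  ultimately show ?thesis by (simp only: generated_subalgebra_def)
qed

lemma const_in_zero_sum_polys: "mpoly_const c \<in> zero_sum_polys"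
  using mpoly_const_in_carrier[of c n]
  by (auto simp: zero_sum_polys_def supported_def mpoly_const_def wt_def)

lemma mono_vec_in_zero_sum_polys: "e dvd wt (vec a) \<Longrightarrow> mono (vec a) \<in> zero_sum_polys"
  using mono_vec_in_carrier[of a] by (auto simp: zero_sum_polys_def supported_def)

lemma zero_sum_polys_mult: "p \<in> zero_sum_polys \<Longrightarrow> r \<in> zero_sum_polys \<Longrightarrow> p * r \<in> zero_sum_polys"
  unfolding zero_sum_polys_def by (erule (1) supported_mult) (auto simp: high_add wt_add)

text \<open>The carrier is an intersection, so one subring that is a subalgebra and contains the
  generators bounds it from above. In the other direction, membership is established for the
  generating monomials and the scalars.\<close>

lemma carrier_B_subset: "carrier B \<subseteq> proj ` zero_sum_polys"
proof -
  have one: "1 \<in> zero_sum_polys" using const_in_zero_sum_polys[of 1] by (simp add: mpoly_const_def)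
  have "subring zero_sum_polys P"
  proof (rule P.subringI)
    show "zero_sum_polys \<subseteq> carrier P" by (auto simp: zero_sum_polys_def supported_def)
    show "\<ominus>\<^bsub>P\<^esub> h \<in> zero_sum_polys" if "h \<in> zero_sum_polys" for h
      using that supported_uminus P_uminus supported_carrier by (simp add: zero_sum_polys_def)
    show "h1 \<oplus>\<^bsub>P\<^esub> h2 \<in> zero_sum_polys" if "h1 \<in> zero_sum_polys" "h2 \<in> zero_sum_polys" for h1 h2
      using that supported_add by (simp add: zero_sum_polys_def P_simps)
  qed (simp_all add: P_simps one zero_sum_polys_mult)
  note zs = subringE[OF this]
  have sub: "subring (proj ` zero_sum_polys) Q"
  proof (rule Q.subringI)
    show "\<ominus>\<^bsub>Q\<^esub> h \<in> proj ` zero_sum_polys" if h: "h \<in> proj ` zero_sum_polys" for h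
    proof -
      obtain p where p: "h = proj p" "p \<in> zero_sum_polys" using h by blast
      then have "\<ominus>\<^bsub>Q\<^esub> h = proj (\<ominus>\<^bsub>P\<^esub> p)" using zs(1) by (simp add: subsetD)
      then show ?thesis using zs(5)[OF p(2)] by blast
    qed
    show "h1 \<otimes>\<^bsub>Q\<^esub> h2 \<in> proj ` zero_sum_polys" "h1 \<oplus>\<^bsub>Q\<^esub> h2 \<in> proj ` zero_sum_polys"
      if h: "h1 \<in> proj ` zero_sum_polys" "h2 \<in> proj ` zero_sum_polys" for h1 h2
    proof -
      obtain p r where p: "h1 = proj p" "p \<in> zero_sum_polys" "h2 = proj r" "r \<in> zero_sum_polys"
        using h by blast
      then have "h1 \<otimes>\<^bsub>Q\<^esub> h2 = proj (p \<otimes>\<^bsub>P\<^esub> r)" "h1 \<oplus>\<^bsub>Q\<^esub> h2 = proj (p \<oplus>\<^bsub>P\<^esub> r)"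
        using zs(1) by (simp_all add: subsetD)
      then show "h1 \<otimes>\<^bsub>Q\<^esub> h2 \<in> proj ` zero_sum_polys" "h1 \<oplus>\<^bsub>Q\<^esub> h2 \<in> proj ` zero_sum_polys"
        using zs(6,7)[OF p(2,4)] by auto
    qed
    show "\<one>\<^bsub>Q\<^esub> \<in> proj ` zero_sum_polys" using zs(3) proj.hom_one by (metis imageI)
    show "proj ` zero_sum_polys \<subseteq> carrier Q" using zs(1) by auto
  qed
  moreover have "subalgebra (scalars) (proj ` zero_sum_polys) Q"
  proof (intro subalgebra.intro subalgebra_axioms.intro)
    show "subgroup (proj ` zero_sum_polys) (add_monoid Q)" using sub by (rule subring.axioms)
    fix k x assume "k \<in> scalars" and x: "x \<in> proj ` zero_sum_polys"
    then have "k \<in> proj ` zero_sum_polys" using const_in_zero_sum_polys by (auto simp: trunc_scalars_def)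
    then show "k \<otimes>\<^bsub>Q\<^esub> x \<in> proj ` zero_sum_polys" using x by (rule subringE(6)[OF sub])
  qed
  moreover have "(\<lambda>a. proj (mono (vec a))) ` {a. e dvd wt (vec a)} \<subseteq> proj ` zero_sum_polys"
    using mono_vec_in_zero_sum_polys by blast
  ultimately show ?thesis unfolding carrier_B by (intro Inter_lower CollectI conjI)
qed

lemma trunc_monom_in_B:
  assumes "e dvd wt (vec a)"
  shows "proj (mono (vec a)) \<in> carrier B"
  unfolding carrier_B
proof (rule InterI)
  fix S assume "S \<in> {S. subring S Q \<and> subalgebra scalars S Q \<and>
    (\<lambda>a. proj (mono (vec a))) ` {a. e dvd wt (vec a)} \<subseteq> S}"
  then have "(\<lambda>a. proj (mono (vec a))) ` {a. e dvd wt (vec a)} \<subseteq> S" by simp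
  moreover have "proj (mono (vec a)) \<in> (\<lambda>a. proj (mono (vec a))) ` {a. e dvd wt (vec a)}"
    using assms by (intro image_eqI[of _ _ a] CollectI refl)
  ultimately show "proj (mono (vec a)) \<in> S" by (rule subsetD)
qed

lemma scalar_in_B: "proj (mpoly_const c) \<in> carrier B"
proof -
  have "proj (mpoly_const c) \<in> S" if S: "subring S Q" "subalgebra (scalars) S Q" for S
  proof -
    have "proj (mpoly_const c) \<in> scalars" by (simp add: trunc_scalars_def)
    then have "proj (mpoly_const c) \<otimes>\<^bsub>Q\<^esub> \<one>\<^bsub>Q\<^esub> \<in> S"
      using subalgebra.smult_closed[OF S(2)] subringE(3)[OF S(1)] by blast
    then show ?thesis using mpoly_const_in_carrier[of c n] by simp
  qed
  then show ?thesis unfolding carrier_B by (intro InterI) (simp only: mem_Collect_eq)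
qed

end

section \<open>The Loewy length\<close>

context truncated_polynomials
begin

text \<open>The \<open>high\<close> monomials count in every degree: they vanish modulo
  \<open>I\<close>, and representatives taken from \<open>zero_sum_polys\<close> may contain
  them.\<close>

definition degree_ge :: "nat \<Rightarrow> 'f mpoly set" where
  "degree_ge t = supported (\<lambda>v. high v \<or> t \<le> deg v)"

lemma degree_ge_mult: "p \<in> degree_ge s \<Longrightarrow> r \<in> degree_ge t \<Longrightarrow> p * r \<in> degree_ge (s + t)"
  unfolding degree_ge_def by (erule (1) supported_mult) (auto simp: high_add deg_add)

lemma degree_ge_large:
  assumes "n * (q - 1) < t"
  shows "degree_ge t \<subseteq> I"
  unfolding degree_ge_def trunc_ideal_eq
proof (rule supported_mono)
  fix v assume v: "high v \<or> t \<le> deg v"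
  show "high v"
  proof (rule ccontr)
    assume "\<not> high v"
    then have "Poly_Mapping.lookup v j < q" for j by (simp add: high_def not_le)
    then have "Poly_Mapping.lookup v j \<le> q - 1" for j using q_gt_1 less_Suc_eq_le[of _ "q - 1"] by simp
    then have "deg v \<le> (\<Sum>j = 1..n. q - 1)" unfolding deg_def by (intro sum_mono)
    then show False using v \<open>\<not> high v\<close> assms by simp
  qed
qed

text \<open>This is the kernel of the constant-term map, expressed through representatives. It
  supplies the one maximal ideal that bounds the radical from above.\<close>

definition augmentation_ideal :: "'f mpoly set set" where
  "augmentation_ideal =
    {x \<in> carrier B. \<exists>p \<in> zero_sum_polys. x = proj p \<and> 0 \<notin> Poly_Mapping.keys p}"

lemma zero_sum_polys_carrier: "p \<in> zero_sum_polys \<Longrightarrow> p \<in> carrier P"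
  by (simp add: zero_sum_polys_def supported_def)

lemma proj_add: "p \<in> carrier P \<Longrightarrow> r \<in> carrier P \<Longrightarrow> proj p \<oplus>\<^bsub>Q\<^esub> proj r = proj (p + r)"
  using proj.hom_add[of p r] by (simp add: P_simps)

lemma proj_mult: "p \<in> carrier P \<Longrightarrow> r \<in> carrier P \<Longrightarrow> proj p \<otimes>\<^bsub>Q\<^esub> proj r = proj (p * r)"
  using proj.hom_mult[of p r] by (simp add: P_simps)

lemma proj_one: "\<one>\<^bsub>Q\<^esub> = proj 1"
  using proj.hom_one by (simp add: P_simps)

lemma proj_zero: "\<zero>\<^bsub>Q\<^esub> = proj 0"
  using proj.hom_zero by (simp add: P_simps)

lemma zero_notin_keys_mult: "0 \<notin> Poly_Mapping.keys (p * r)"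
  if "0 \<notin> Poly_Mapping.keys p" for p r :: "'f mpoly"
proof
  assume "0 \<in> Poly_Mapping.keys (p * r)"
  then obtain a b where ab: "a \<in> Poly_Mapping.keys p" "0 = a + b" using keys_mult[of p r] by blast
  have "Poly_Mapping.lookup (a + b) j = 0" for j using ab(2) by (metis lookup_zero)
  then have "a = 0" by (intro poly_mapping_eqI) (simp add: lookup_add)
  then show False using ab that by simp
qed

lemma augmentation_ideal_ideal: "ideal augmentation_ideal B"
proof (rule idealI)
  show "ring B" by (rule B.ring_axioms)
  show "subgroup augmentation_ideal (add_monoid B)"
  proof (rule B.add.subgroupI)
    show "augmentation_ideal \<subseteq> carrier B" by (auto simp: augmentation_ideal_def)
    have "\<zero>\<^bsub>B\<^esub> \<in> augmentation_ideal"
      unfolding augmentation_ideal_def mem_Collect_eq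
    proof (intro conjI bexI)
      show "\<zero>\<^bsub>B\<^esub> = proj 0" using proj_zero by (simp only: B_simps)
    qed (simp_all add: zero_sum_polys_def zero_in_supported)
    then show "augmentation_ideal \<noteq> {}" by blast
    show "x \<oplus>\<^bsub>B\<^esub> y \<in> augmentation_ideal" if xy: "x \<in> augmentation_ideal" "y \<in> augmentation_ideal" for x y
    proof -
      from xy obtain p r where p: "p \<in> zero_sum_polys" "x = proj p" "0 \<notin> Poly_Mapping.keys p"
        and r: "r \<in> zero_sum_polys" "y = proj r" "0 \<notin> Poly_Mapping.keys r"
        unfolding augmentation_ideal_def by blast
      have "x \<oplus>\<^bsub>B\<^esub> y = proj (p + r)"
        using p r by (simp only: B_simps proj_add zero_sum_polys_carrier)
      moreover have "p + r \<in> zero_sum_polys"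
        using p r by (simp only: zero_sum_polys_def supported_add)
      moreover have "0 \<notin> Poly_Mapping.keys (p + r)"
        using p(3) r(3) Poly_Mapping.keys_add[of p r] by blast
      moreover have "x \<oplus>\<^bsub>B\<^esub> y \<in> carrier B"
        using xy by (intro B.add.m_closed) (simp_all add: augmentation_ideal_def)
      ultimately show ?thesis unfolding augmentation_ideal_def by blast
    qed
    show "\<ominus>\<^bsub>B\<^esub> x \<in> augmentation_ideal" if x: "x \<in> augmentation_ideal" for x
    proof -
      from x obtain p where p: "p \<in> zero_sum_polys" "x = proj p" "0 \<notin> Poly_Mapping.keys p"
        and xB: "x \<in> carrier B"
        unfolding augmentation_ideal_def by blast
      have m: "- p \<in> zero_sum_polys"
        using p(1) by (simp only: zero_sum_polys_def supported_uminus)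
      \<comment> \<open>Writing the negative as a product with the scalar -1 shows that it stays in
        the generated subalgebra.\<close>
      have "proj (- p) = proj (mpoly_const (- 1)) \<otimes>\<^bsub>B\<^esub> x"
      proof -
        have "- p = mpoly_const (- 1) * p" by (simp add: mpoly_const_def single_uminus)
        then show ?thesis
          using p by (simp only: B_simps proj_mult zero_sum_polys_carrier mpoly_const_in_carrier)
      qed
      then have mB: "proj (- p) \<in> carrier B" using B.m_closed[OF scalar_in_B xB] by simp
      have "proj (- p) \<oplus>\<^bsub>B\<^esub> x = \<zero>\<^bsub>B\<^esub>"
        using p m by (simp only: B_simps proj_add zero_sum_polys_carrier proj_zero add.left_inverse)
      then have "\<ominus>\<^bsub>B\<^esub> x = proj (- p)" by (rule B.minus_equality[OF _ xB mB])
      then show ?thesis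
        using m mB p(3) unfolding augmentation_ideal_def by auto
    qed
  qed
  show l: "x \<otimes>\<^bsub>B\<^esub> a \<in> augmentation_ideal" if a: "a \<in> augmentation_ideal" and x: "x \<in> carrier B" for a x
  proof -
    from a obtain p where p: "p \<in> zero_sum_polys" "a = proj p" "0 \<notin> Poly_Mapping.keys p"
      and aB: "a \<in> carrier B" unfolding augmentation_ideal_def by blast
    obtain r where r: "r \<in> zero_sum_polys" "x = proj r" using x carrier_B_subset by blast
    have "x \<otimes>\<^bsub>B\<^esub> a = proj (p * r)"
      using p r by (simp only: B_simps proj_mult zero_sum_polys_carrier mult.commute)
    moreover have "p * r \<in> zero_sum_polys" by (rule zero_sum_polys_mult[OF p(1) r(1)])
    moreover have "0 \<notin> Poly_Mapping.keys (p * r)" by (rule zero_notin_keys_mult[OF p(3)])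
    moreover have "x \<otimes>\<^bsub>B\<^esub> a \<in> carrier B" by (rule B.m_closed[OF x aB])
    ultimately show ?thesis unfolding augmentation_ideal_def by blast
  qed
  show "a \<otimes>\<^bsub>B\<^esub> x \<in> augmentation_ideal" if a: "a \<in> augmentation_ideal" and x: "x \<in> carrier B" for a x
  proof -
    have "a \<in> carrier B" using a by (simp add: augmentation_ideal_def)
    then have "a \<otimes>\<^bsub>B\<^esub> x = x \<otimes>\<^bsub>B\<^esub> a" using x by (rule B.m_comm)
    then show ?thesis using l[OF a x] by (simp only:)
  qed
qed

text \<open>Otherwise 1 - p would lie in \<open>I\<close> for some p without constant term, but the
  constant monomial is not \<open>high\<close>.\<close>

lemma one_notin_augmentation_ideal: "\<one>\<^bsub>B\<^esub> \<notin> augmentation_ideal"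
proof
  assume "\<one>\<^bsub>B\<^esub> \<in> augmentation_ideal"
  then obtain p where p: "p \<in> zero_sum_polys" "proj 1 = proj p" "0 \<notin> Poly_Mapping.keys p"
    unfolding augmentation_ideal_def B_simps proj_one by blast
  have c: "p \<in> carrier P" "- p \<in> carrier P" "1 \<in> carrier P"
    using zero_sum_polys_carrier[OF p(1)] by (auto simp: in_carrier_P)
  have "proj (1 + - p) = proj 1 \<oplus>\<^bsub>Q\<^esub> proj (- p)" by (rule proj_add[symmetric, OF c(3,2)])
  also have "\<dots> = proj p \<oplus>\<^bsub>Q\<^esub> proj (- p)" using p(2) by (simp only:)
  also have "\<dots> = \<zero>\<^bsub>Q\<^esub>" using c by (simp only: proj_add proj_zero add.right_inverse)
  finally have "1 + - p \<in> I"
    using proj_eq_zero_iff P.add.m_closed[OF c(3,2)] by (simp only: P_simps)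
  moreover have "0 \<in> Poly_Mapping.keys (1 + - p)"
    using p(3) by (simp add: in_keys_iff lookup_minus lookup_one)
  ultimately show False using not_high_0 unfolding trunc_ideal_eq supported_def by blast
qed

text \<open>Modulo this ideal every element is the scalar given by its constant term, and nonzero
  scalars are units.\<close>

lemma augmentation_ideal_maximal: "maximalideal augmentation_ideal B"
proof (rule maximalidealI[OF augmentation_ideal_ideal])
  show "carrier B \<noteq> augmentation_ideal" using one_notin_augmentation_ideal B.one_closed by metis
next
  fix K assume K: "ideal K B" and sub: "augmentation_ideal \<subseteq> K" and KB: "K \<subseteq> carrier B"
  show "K = augmentation_ideal \<or> K = carrier B"
  proof (rule disjCI)
    assume "K \<noteq> carrier B"
    interpret K: ideal K B by (rule K)
    have "K \<subseteq> augmentation_ideal"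
    proof
      fix x assume x: "x \<in> K"
      then have xB: "x \<in> carrier B" using KB by blast
      then obtain p where p: "p \<in> zero_sum_polys" "x = proj p" using carrier_B_subset by blast
      define c where "c = Poly_Mapping.lookup p 0"
      show "x \<in> augmentation_ideal"
      proof (cases "c = 0")
        case True
        then show ?thesis
          using p xB unfolding augmentation_ideal_def c_def by (blast intro: in_keys_iff[THEN iffD1])
      next
        case False
        define r where "r = mpoly_const (- c) + p"
        have pc: "p \<in> carrier P" using p zero_sum_polys_carrier by blast
        have cc: "mpoly_const a \<in> carrier P" for a :: 'f by (rule mpoly_const_in_carrier)
        have rx: "proj r = proj (mpoly_const (- c)) \<oplus>\<^bsub>B\<^esub> x"
          unfolding r_def using p pc cc by (simp only: B_simps proj_add)
        then have "proj r \<in> carrier B" using B.add.m_closed[OF scalar_in_B xB] by simp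
        moreover have "r \<in> zero_sum_polys"
          using const_in_zero_sum_polys p unfolding r_def zero_sum_polys_def by (intro supported_add)
        moreover have "0 \<notin> Poly_Mapping.keys r"
          by (simp add: r_def in_keys_iff lookup_add mpoly_const_def c_def)
        ultimately have "proj r \<in> K" using sub unfolding augmentation_ideal_def by blast
        \<comment> \<open>As r = p - c, the combination p - r recovers the scalar c inside
          \<open>K\<close>.\<close>
        have cancel: "proj (mpoly_const (- 1)) \<otimes>\<^bsub>B\<^esub> proj r \<oplus>\<^bsub>B\<^esub> x = proj (mpoly_const c)"
        proof -
          have "mpoly_const (- 1) * r + p = mpoly_const c"
            by (simp add: r_def mpoly_const_def single_uminus)
          then show ?thesis
            using p pc cc P.add.m_closed[OF cc pc] P.m_closed[OF cc P.add.m_closed[OF cc pc]]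
            by (simp only: B_simps proj_mult proj_add P_simps r_def)
        qed
        have "proj (mpoly_const (- 1)) \<otimes>\<^bsub>B\<^esub> proj r \<in> K"
          by (rule K.I_l_closed[OF \<open>proj r \<in> K\<close> scalar_in_B])
        then have "proj (mpoly_const c) \<in> K" using K.a_closed[OF _ x] cancel by metis
        then have "proj (mpoly_const (1 / c)) \<otimes>\<^bsub>B\<^esub> proj (mpoly_const c) \<in> K"
          by (rule K.I_l_closed[OF _ scalar_in_B])
        moreover have "mpoly_const (1 / c) * mpoly_const c = (1 :: 'f mpoly)"
          using False by (simp add: mpoly_const_def mult_single)
        ultimately have "\<one>\<^bsub>B\<^esub> \<in> K" using cc by (simp only: B_simps proj_mult proj_one)
        then show ?thesis using K.one_imp_carrier \<open>K \<noteq> carrier B\<close> by blast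
      qed
    qed
    then show "K = augmentation_ideal" using sub by blast
  qed
qed

text \<open>A monomial that is not \<open>high\<close> in a representative without constant term is
  a nonempty list of exponents, with j - 1 repeated as often as variable j occurs. Its length is the
  degree and its power sum is the weight, which \<open>e\<close> divides.\<close>

lemma jacobson_radical_subset: "jacobson_radical B \<subseteq> proj ` degree_ge (min_power_sum_length q e)"
proof
  fix x assume "x \<in> jacobson_radical B"
  then have "x \<in> augmentation_ideal"
    using augmentation_ideal_maximal unfolding jacobson_radical_def by blast
  then obtain p where p: "p \<in> zero_sum_polys" "x = proj p" "0 \<notin> Poly_Mapping.keys p"
    unfolding augmentation_ideal_def by blast
  have "min_power_sum_length q e \<le> deg v" if v: "v \<in> Poly_Mapping.keys p" "\<not> high v" for v
  proof -
    have dvd: "e dvd wt v" and v_n: "Poly_Mapping.keys v \<subseteq> {1..n}"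
      using p(1) v unfolding zero_sum_polys_def supported_def in_carrier_P by blast+
    have "v \<noteq> 0" using v(1) p(3) by metis
    then obtain j where j: "j \<in> Poly_Mapping.keys v" by (metis keys_eq_empty ex_in_conv)
    define ks where "ks = concat (map (\<lambda>j. replicate (Poly_Mapping.lookup v j) (j - 1)) [1..<n + 1])"
    have set_n: "{1..n} = set [1..<n + 1]" by auto
    have "length ks = deg v"
      unfolding ks_def deg_def set_n by (simp add: length_concat comp_def sum_list_distinct_conv_sum_set)
    moreover have "(\<Sum>k\<leftarrow>ks. q ^ k) = wt v"
    proof -
      have "(\<Sum>k\<leftarrow>concat (map (\<lambda>j. replicate (Poly_Mapping.lookup v j) (j - 1)) js). q ^ k)
          = (\<Sum>j\<leftarrow>js. q ^ (j - 1) * Poly_Mapping.lookup v j)" for js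
        by (induction js) (simp_all add: sum_list_replicate mult.commute)
      then show ?thesis
        unfolding ks_def wt_def set_n by (simp only: sum_list_distinct_conv_sum_set distinct_upt)
    qed
    moreover have "deg v > 0"
      unfolding deg_def
    proof (rule sum_pos2)
      show "j \<in> {1..n}" using j v_n by (rule subsetD[rotated])
      show "0 < Poly_Mapping.lookup v j" using j by (simp add: in_keys_iff)
    qed simp_all
    ultimately show ?thesis using min_power_sum_length_le[of ks e q] dvd by (cases "ks = []") auto
  qed
  then have "p \<in> degree_ge (min_power_sum_length q e)"
    using zero_sum_polys_carrier[OF p(1)] unfolding degree_ge_def supported_def by blast
  then show "x \<in> proj ` degree_ge (min_power_sum_length q e)" using p(2) by blast
qed

section \<open>Powers of the radical: the degree bound and surviving products\<close>

lemma radical_power_Suc: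
  "jacobson_radical B [^]\<^bsub>ideals_set B\<^esub> Suc l
    = ideal_prod B (jacobson_radical B [^]\<^bsub>ideals_set B\<^esub> l) (jacobson_radical B)"
  by (simp add: nat_pow_def ideals_set_def)

lemma radical_power_0: "jacobson_radical B [^]\<^bsub>ideals_set B\<^esub> (0 :: nat) = carrier B"
  by (simp add: nat_pow_def ideals_set_def)

lemma radical_power_subset:
  "jacobson_radical B [^]\<^bsub>ideals_set B\<^esub> l \<subseteq> proj ` degree_ge (l * min_power_sum_length q e)"
proof (induction l)
  case 0
  have "degree_ge 0 = carrier P" unfolding degree_ge_def carrier_eq_supported by simp
  moreover have "carrier B \<subseteq> proj ` carrier P"
    using carrier_B_subset zero_sum_polys_carrier by blast
  ultimately show ?case by (simp only: radical_power_0 mult_0)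
next
  case (Suc l)
  let ?m = "min_power_sum_length q e"
  have closed: "p \<in> carrier P" if "p \<in> degree_ge t" for p t
    using that unfolding degree_ge_def by (rule supported_carrier)
  show ?case
  proof
    fix x assume "x \<in> jacobson_radical B [^]\<^bsub>ideals_set B\<^esub> Suc l"
    then show "x \<in> proj ` degree_ge (Suc l * ?m)"
      unfolding radical_power_Suc
    proof (induction x rule: ideal_prod.induct)
      case (prod i j)
      obtain p r where p: "p \<in> degree_ge (l * ?m)" "i = proj p" and r: "r \<in> degree_ge ?m" "j = proj r"
        using subsetD[OF Suc.IH prod(1)] subsetD[OF jacobson_radical_subset prod(2)] by blast
      have "i \<otimes>\<^bsub>B\<^esub> j = proj (p * r)"
        using p r closed by (simp only: B_simps proj_mult)
      moreover have "p * r \<in> degree_ge (Suc l * ?m)"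
        using degree_ge_mult[OF p(1) r(1)] by (simp only: mult_Suc add.commute)
      ultimately show ?case by blast
    next
      case (sum x y)
      then obtain p r where p: "p \<in> degree_ge (Suc l * ?m)" "x = proj p"
        and r: "r \<in> degree_ge (Suc l * ?m)" "y = proj r" by blast
      have "x \<oplus>\<^bsub>B\<^esub> y = proj (p + r)"
        using p r closed by (simp only: B_simps proj_add)
      moreover have "p + r \<in> degree_ge (Suc l * ?m)"
        using p(1) r(1) unfolding degree_ge_def by (rule supported_add)
      ultimately show ?case by blast
    qed
  qed
qed

lemma zero_in_radical_power: "\<zero>\<^bsub>B\<^esub> \<in> jacobson_radical B [^]\<^bsub>ideals_set B\<^esub> (l :: nat)"
proof (induction l)
  case 0
  show ?case unfolding radical_power_0 by (rule B.zero_closed)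
next
  case (Suc l)
  have "\<zero>\<^bsub>B\<^esub> \<in> jacobson_radical B"
    unfolding jacobson_radical_def
    by (auto simp: maximalideal_def intro: additive_subgroup.zero_closed ideal.axioms(1))
  then have "\<zero>\<^bsub>B\<^esub> \<otimes>\<^bsub>B\<^esub> \<zero>\<^bsub>B\<^esub> \<in> jacobson_radical B [^]\<^bsub>ideals_set B\<^esub> Suc l"
    unfolding radical_power_Suc by (rule ideal_prod.prod[OF Suc])
  then show ?case by simp
qed

lemma radical_power_eq_zero:
  assumes "n * (q - 1) < l * min_power_sum_length q e"
  shows "jacobson_radical B [^]\<^bsub>ideals_set B\<^esub> l = {\<zero>\<^bsub>B\<^esub>}"
proof -
  have "x = \<zero>\<^bsub>B\<^esub>" if x: "x \<in> jacobson_radical B [^]\<^bsub>ideals_set B\<^esub> l" for x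
  proof -
    obtain p where p: "p \<in> degree_ge (l * min_power_sum_length q e)" "x = proj p"
      using subsetD[OF radical_power_subset x] by blast
    have "p \<in> I" using p(1) degree_ge_large[OF assms] by blast
    moreover have "p \<in> carrier P" using p(1) unfolding degree_ge_def by (rule supported_carrier)
    ultimately show ?thesis using p(2) proj_eq_zero_iff by (simp only: B_simps)
  qed
  then show ?thesis using zero_in_radical_power by blast
qed

text \<open>The q-th power of a nontrivial monomial is 0, and a nilpotent element lies in every
  prime ideal, in particular in every maximal ideal.\<close>

lemma mono_in_jacobson_radical:
  assumes dvd: "e dvd wt (vec a)" and j: "j \<in> {1..n}" "a j \<noteq> 0"
  shows "proj (mono (vec a)) \<in> jacobson_radical B"
proof -
  let ?x = "proj (mono (vec a))"
  have xB: "?x \<in> carrier B" by (rule trunc_monom_in_B[OF dvd])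
  have "?x \<in> M" if M: "maximalideal M B" for M
  proof -
    interpret M: primeideal M B by (rule B.maximalideal_prime[OF M])
    have one: "\<one>\<^bsub>B\<^esub> \<notin> M" using M.one_imp_carrier M.I_notcarr by metis
    have mult: "vec (\<lambda>j. Suc k * a j) = vec a + vec (\<lambda>j. k * a j)" for k
      using vec_add[of a "\<lambda>j. k * a j"] by simp
    have dvd_k: "e dvd wt (vec (\<lambda>j. k * a j))" for k
    proof (induction k)
      case (Suc k)
      then show ?case unfolding mult wt_add using dvd by simp
    qed (simp add: wt_vec)
    \<comment> \<open>Primality lowers the power one factor at a time; reaching the zeroth power
      would put 1 into \<open>M\<close>.\<close>
    have step: "?x \<in> M" if "proj (mono (vec (\<lambda>j. k * a j))) \<in> M" for k
      using that
    proof (induction k)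
      case 0
      then show ?case using one by (simp add: vec_0 B_simps proj_one)
    next
      case (Suc k)
      have "proj (mono (vec (\<lambda>j. Suc k * a j))) = ?x \<otimes>\<^bsub>B\<^esub> proj (mono (vec (\<lambda>j. k * a j)))"
        by (simp only: mult mono_add B_simps proj_mult mono_vec_in_carrier)
      then have "?x \<in> M \<or> proj (mono (vec (\<lambda>j. k * a j))) \<in> M"
        using Suc.prems M.I_prime[OF xB trunc_monom_in_B[OF dvd_k]] by (simp only:)
      then show ?case using Suc.IH by blast
    qed
    have "high (vec (\<lambda>j. q * a j))"
      unfolding high_def lookup_vec using j by (intro exI[of _ j]) simp
    then have "mono (vec (\<lambda>j. q * a j)) \<in> I"
      using mono_vec_in_carrier unfolding trunc_ideal_eq supported_def by simp
    then have "proj (mono (vec (\<lambda>j. q * a j))) = \<zero>\<^bsub>B\<^esub>"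
      using proj_eq_zero_iff[OF mono_vec_in_carrier] by (simp only: B_simps)
    then show ?thesis using step[of q] M.zero_closed by (simp only:)
  qed
  then show ?thesis using xB unfolding jacobson_radical_def by blast
qed

text \<open>The product of the first \<open>l\<close> monomials lies in the l-th power of the
  radical, and its exponents stay below \<open>q\<close>, so it is not in \<open>I\<close>.\<close>

lemma radical_power_neq_zero:
  fixes V :: "nat \<Rightarrow> nat \<Rightarrow> nat" and l L :: nat
  assumes V: "\<And>l. l < L \<Longrightarrow> e dvd wt (vec (V l))" "\<And>l. l < L \<Longrightarrow> \<exists>j\<in>{1..n}. V l j \<noteq> 0"
    and total: "\<And>j. j \<in> {1..n} \<Longrightarrow> (\<Sum>l<L. V l j) \<le> q - 1" and l: "l \<le> L"
  shows "jacobson_radical B [^]\<^bsub>ideals_set B\<^esub> l \<noteq> {\<zero>\<^bsub>B\<^esub>}"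
proof
  let ?y = "\<lambda>l. proj (mono (vec (\<lambda>j. \<Sum>i<l. V i j)))"
  assume zero: "jacobson_radical B [^]\<^bsub>ideals_set B\<^esub> l = {\<zero>\<^bsub>B\<^esub>}"
  have "?y k \<in> jacobson_radical B [^]\<^bsub>ideals_set B\<^esub> k" if "k \<le> L" for k
    using that
  proof (induction k)
    case 0
    have "?y 0 = \<one>\<^bsub>B\<^esub>" by (simp add: vec_0 B_simps proj_one)
    then show ?case unfolding radical_power_0 using B.one_closed by (simp only:)
  next
    case (Suc k)
    obtain j where j: "j \<in> {1..n}" "V k j \<noteq> 0" using V(2)[of k] Suc.prems by auto
    have "proj (mono (vec (V k))) \<in> jacobson_radical B"
      using V(1)[of k] Suc.prems by (intro mono_in_jacobson_radical[of "V k" j] j) simp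
    moreover have "?y k \<in> jacobson_radical B [^]\<^bsub>ideals_set B\<^esub> k" using Suc by simp
    ultimately have "?y k \<otimes>\<^bsub>B\<^esub> proj (mono (vec (V k))) \<in> jacobson_radical B [^]\<^bsub>ideals_set B\<^esub> Suc k"
      unfolding radical_power_Suc by (intro ideal_prod.prod)
    moreover have "?y k \<otimes>\<^bsub>B\<^esub> proj (mono (vec (V k))) = ?y (Suc k)"
      by (simp only: B_simps proj_mult mono_vec_in_carrier mono_add[symmetric] vec_add[symmetric] sum.lessThan_Suc)
    ultimately show ?case by (simp only:)
  qed
  from this[OF l] have "?y l = \<zero>\<^bsub>Q\<^esub>" using zero by (simp only: B_simps singleton_iff)
  then have "mono (vec (\<lambda>j. \<Sum>i<l. V i j)) \<in> I"
    using proj_eq_zero_iff[OF mono_vec_in_carrier] by (simp only:)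
  then have "high (vec (\<lambda>j. \<Sum>i<l. V i j))" unfolding trunc_ideal_eq supported_def by simp
  then obtain j where "q \<le> (if j \<in> {1..n} then \<Sum>i<l. V i j else 0)"
    unfolding high_def lookup_vec by blast
  then have j: "j \<in> {1..n}" "q \<le> (\<Sum>i<l. V i j)" using q_gt_1 by (auto split: if_splits)
  have "(\<Sum>i<l. V i j) \<le> (\<Sum>i<L. V i j)" using l by (intro sum_mono2) auto
  then show False using total[OF j(1)] j(2) q_gt_1 by linarith
qed

text \<open>Degree n(q - 1) = m L is still attainable and (L + 1) m is not, so the power L + 1
  vanishes; the splitting keeps all powers up to L alive.\<close>

lemma loewy_length_eq:
  assumes L: "min_power_sum_length q e * L = n * (q - 1)" and split: "splits_into q n e L"
  shows "loewy_length B = L + 1"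
  unfolding loewy_length_def
proof (rule Least_equality)
  have "0 < min_power_sum_length q e" using L n_ge_1 q_gt_1 by (intro Nat.gr0I) simp
  then show "jacobson_radical B [^]\<^bsub>ideals_set B\<^esub> (L + 1) = {\<zero>\<^bsub>B\<^esub>}"
    using L by (intro radical_power_eq_zero) (simp add: mult.commute)
next
  obtain V where V: "\<forall>l<L. e dvd wt (vec (V l)) \<and> (\<exists>j\<in>{1..n}. V l j \<noteq> 0)"
    "\<forall>j\<in>{1..n}. (\<Sum>l<L. V l j) \<le> q - 1"
    using split unfolding splits_into_def wt_vec by (elim exE conjE)
  fix l :: nat assume "jacobson_radical B [^]\<^bsub>ideals_set B\<^esub> l = {\<zero>\<^bsub>B\<^esub>}"
  then have "\<not> l \<le> L" using radical_power_neq_zero[of L V l] V by blast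
  then show "L + 1 \<le> l" by simp
qed

end

theorem proposition6p4:
  fixes q n e :: nat
  assumes "n \<ge> 1" and "e \<ge> 1" and "q > 1"
    and "e dvd q ^ n - 1"
    and "real (min_power_sum_length q e) \<ge> real e / 3"
  shows "int (loewy_length (monomial_algebra q n e :: ('f::field) mpoly set ring)) =
    \<lfloor>real n * ((real q - 1) / real (min_power_sum_length q e))\<rfloor> + 1"
proof -
  let ?m = "min_power_sum_length q e"
  have q_n: "[q ^ n = 1] (mod e)" using assms(3,4) by (simp add: cong_altdef_nat)
  have "coprime (q ^ n) e" using cong_imp_coprime[OF cong_sym[OF q_n]] by simp
  then have "coprime q e" using assms(1) by simp
  then interpret coprime_base q e "gcd (q - 1) e" "e div gcd (q - 1) e"
    using assms by unfold_locales simp_all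
  interpret truncated_polynomials q n e "TYPE('f)"
    using assms by unfold_locales
  have "real e \<le> real (3 * ?m)" using assms(5) by simp
  then have "e \<le> 3 * ?m" by (simp only: of_nat_le_iff)
  then obtain L where L: "?m * L = n * (q - 1)" "splits_into q n e L"
    using splits_into_if_large[OF _ assms(1) q_n] by metis
  have pos: "?m > 0" using L(1) assms(1,3) by (intro Nat.gr0I) simp
  have "real ?m * real L = real n * (real q - 1)"
    using arg_cong[OF L(1), of real] assms(3) by (simp add: of_nat_diff)
  \<comment> \<open>The quotient is the integer \<open>L\<close>, so the floor changes
    nothing.\<close>
  then have "real n * ((real q - 1) / real ?m) = real L" using pos by (simp add: field_simps)
  then show ?thesis using loewy_length_eq[OF L] by simp
qed

end
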